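(* Let $\mathbb{F}$ be an algebraically closed field. The following two statements are equivalent. (T) For all nonnegative integers $n,m,p$: let $\tilde{\alpha}:\tilde{\alpha}_1|\cdots|\tilde{\alpha}_n$ and $\tilde{\gamma}:\tilde{\gamma}_1|\cdots|\tilde{\gamma}_{n+m+p}$ be chains of monic nonzero homogeneous polynomials in $\mathbb{F}[\lambda,\mu]$, and let $c_1\ge\cdots\ge c_m$ and $r_1\ge\cdots\ge r_p$ be nonnegative integers such that (i) $\tilde{\gamma}_i\mid\tilde{\alpha}_i\mid\tilde{\gamma}_{i+m+p}$ for $i=1,\ldots,n$, and (ii) $(c_1+1,\ldots,c_m+1)\cup(r_1+1,\ldots,r_p+1)\prec\big(d(\tilde{\sigma}_{m+p}(\tilde{\alpha},\tilde{\gamma})),\ldots, d(\tilde{\sigma}_{1}(\tilde{\alpha},\tilde{\gamma}))\big)$. Then there exists a chain $\tilde{\beta}:\tilde{\beta}_1|\cdots|\tilde{\beta}_{n+m}$ of monic nonzero homogeneous polynomials in $\mathbb{F}[\lambda,\mu]$ such that $\tilde{\beta}_i|\tilde{\alpha}_i|\tilde{\beta}_{i+m}$ for $i=1,\ldots,n$; $\tilde{\gamma}_i|\tilde{\beta}_i|\tilde{\gamma}_{i+p}$ for $i=1,\ldots,n+m$; $(c_1+1,\ldots,c_m+1)\prec\big(d(\tilde{\sigma}_m(\tilde{\alpha},\tilde{\beta})),\ldots,d(\tilde{\sigma}_1(\tilde{\alpha},\tilde{\beta}))\big)$; and $(r_1+1,\ldots,r_p+1)\prec\big(d(\tilde{\sigma}_p(\tilde{\beta},\tilde{\gamma})),\ldots,d(\tilde{\sigma}_1(\tilde{\beta},\tilde{\gamma}))\big)$.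 (L) For all integers $s,k\ge1$: if $\mathbf{d}^i=(d^i_1,\ldots,d^i_s)$ and $\mathbf{t}^i=(t^i_1,\ldots,t^i_s)$, $i=1,\ldots,k$, are partitions of nonnegative integers with $d^i_j\ge t^i_j$ for all $i,j$, and $\mathbf{A}=(A_1,\ldots,A_s)$, $\mathbf{B}=(B_1,\ldots,B_s)$ are partitions of nonnegative integers with $(\mathbf{d}^1-\mathbf{t}^1)\cup\cdots\cup(\mathbf{d}^k-\mathbf{t}^k)\prec \mathbf{A}+\mathbf{B}$, then there exist partitions $\mathbf{f}^i=(f^i_1,\ldots,f^i_s)$, $i=1,\ldots,k$, of nonnegative integers with $d^i_j\ge f^i_j\ge t^i_j$ for all $i,j$, $(\mathbf{f}^1-\mathbf{t}^1)\cup\cdots\cup(\mathbf{f}^k-\mathbf{t}^k)\prec \mathbf{A}$ and $(\mathbf{d}^1-\mathbf{f}^1)\cup\cdots\cup(\mathbf{d}^k-\mathbf{f}^k)\prec \mathbf{B}$.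
   Context: Polynomial conventions: for a chain $\tilde{\alpha}_1|\cdots|\tilde{\alpha}_n$ of monic nonzero homogeneous polynomials, one sets $\tilde{\alpha}_i=1$ for $i\le 0$ and $\tilde{\alpha}_i=0$ for $i\ge n+1$; $d(\cdot)$ denotes degree, with $d(1)=0$ and $d(0)=+\infty$. For chains $\tilde{\delta}:\tilde{\delta}_1|\cdots|\tilde{\delta}_x$ and $\tilde{\epsilon}:\tilde{\epsilon}_1|\cdots|\tilde{\epsilon}_{x+y}$ with $\tilde{\epsilon}_i|\tilde{\delta}_i|\tilde{\epsilon}_{i+y}$ ($i=1,\ldots,x$), define $\tilde{\pi}_i(\tilde{\delta},\tilde{\epsilon})=\prod_{j=1}^{x+i}\mathrm{lcm}(\tilde{\delta}_{j-i},\tilde{\epsilon}_j)$ for $i=0,\ldots,y$, and $\tilde{\sigma}_i(\tilde{\delta},\tilde{\epsilon})=\tilde{\pi}_i(\tilde{\delta},\tilde{\epsilon})/\tilde{\pi}_{i-1}(\tilde{\delta},\tilde{\epsilon})$ for $i=1,\ldots,y$. Partition conventions: a partition is a non-increasing sequence of nonnegative integers, identified with any extension by zeros. For partitions $\mathbf{a},\mathbf{b}$ with $a_i\ge b_i$ for all $i$, $\mathbf{a}-\mathbf{b}$ is the non-increasing rearrangement of $(a_i-b_i)_{i\ge1}$; $\mathbf{a}+\mathbf{b}=(a_1+b_1,a_2+b_2,\ldots)$; $\mathbf{a}\cup\mathbf{b}$ is the partition whose nonzero entries are those of $\mathbf{a}$ and $\mathbf{b}$ together (with multiplicity), in non-increasing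 order. For sequences $\mathbf{a}=(a_1,\ldots,a_n)$, $\mathbf{b}=(b_1,\ldots,b_n)$ of nonnegative integers (not necessarily ordered; padded with zeros to equal length if needed) with non-increasing rearrangements $a_{[1]}\ge\cdots\ge a_{[n]}$, $b_{[1]}\ge\cdots\ge b_{[n]}$, $\mathbf{a}\prec\mathbf{b}$ means $\sum_i a_i=\sum_i b_i$ and $\sum_{i=1}^j a_{[i]}\le\sum_{i=1}^j b_{[i]}$ for $j=1,\ldots,n-1$. *)

theory Defs
  imports
    "HOL-Computational_Algebra.Computational_Algebra"
begin

section \<open>Homogeneous polynomials in two variables\<close>

text \<open>
  The ring $F[\lambda,\mu]$ is rendered as \<open>'a poly poly\<close>, that is, as $F[\mu][\lambda]$:
  \<open>coeff (coeff p i) j\<close> is the coefficient of $\lambda^i \mu^j$.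
\<close>

definition homogeneous :: "'a::zero poly poly \<Rightarrow> bool" where
  "homogeneous p \<longleftrightarrow> (\<exists>k. \<forall>i j. coeff (coeff p i) j \<noteq> 0 \<longrightarrow> i + j = k)"

text \<open>
  A homogeneous polynomial is monic if its term with the highest power of $\lambda$ has
  coefficient 1; powers of $\mu$ are thus monic. For nonzero polynomials over a field this is the
  normal form chosen by \<^const>\<open>normalize\<close>, so \<^const>\<open>lcm\<close> returns the monic least common multiple.
\<close>

definition monic2 :: "'a::zero_neq_one poly poly \<Rightarrow> bool" where
  "monic2 p \<longleftrightarrow> lead_coeff (lead_coeff p) = 1"

text \<open>
  The total degree. Its value at 0 (where it would be $+\infty$) is a dummy that is never used: below,
  it is only applied to quotients of nonzero polynomials.
\<close>

definition total_degree :: "'a::zero poly poly \<Rightarrow> nat" where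
  "total_degree p = (if p = 0 then 0 else Max {i + j | i j. coeff (coeff p i) j \<noteq> 0})"

text \<open>
  A chain $\alpha_1 | \cdots | \alpha_n$ is a function on all integers, so that the extension of the
  chain by 1 to the left and by 0 to the right is part of the object.
\<close>

definition hom_chain :: "nat \<Rightarrow> (int \<Rightarrow> 'a::field poly poly) \<Rightarrow> bool" where
  "hom_chain n \<alpha> \<longleftrightarrow>
     (\<forall>i\<le>0. \<alpha> i = 1) \<and>
     (\<forall>i\<in>{1..int n}. \<alpha> i \<noteq> 0 \<and> homogeneous (\<alpha> i) \<and> monic2 (\<alpha> i)) \<and>
     (\<forall>i>int n. \<alpha> i = 0) \<and>
     (\<forall>i\<in>{1..<int n}. \<alpha> i dvd \<alpha> (i + 1))"

text \<open>\<open>interlaced x y \<delta> \<epsilon>\<close> is the condition under which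
  $\pi_i$ and $\sigma_i$ are considered.\<close>

definition interlaced ::
    "nat \<Rightarrow> nat \<Rightarrow> (int \<Rightarrow> 'a::field poly poly) \<Rightarrow> (int \<Rightarrow> 'a poly poly) \<Rightarrow> bool" where
  "interlaced x y \<delta> \<epsilon> \<longleftrightarrow> (\<forall>i\<in>{1..int x}. \<epsilon> i dvd \<delta> i \<and> \<delta> i dvd \<epsilon> (i + int y))"

text \<open>
  Here \<open>x\<close> is the length of the chain \<open>\<delta>\<close>. The class \<^class>\<open>field_gcd\<close> imposes no condition on the
  field; it only fixes its (trivial) operations as a Euclidean ring, from which the library
  constructs \<^const>\<open>lcm\<close> of polynomials.
\<close>

definition chain_pi ::
    "nat \<Rightarrow> int \<Rightarrow> (int \<Rightarrow> 'a::field_gcd poly poly) \<Rightarrow> (int \<Rightarrow> 'a poly poly) \<Rightarrow> 'a poly poly" where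
  "chain_pi x i \<delta> \<epsilon> = (\<Prod>j\<in>{1..int x + i}. lcm (\<delta> (j - i)) (\<epsilon> j))"

text \<open>For two chains and \<open>i \<ge> 1\<close> the following division is exact.\<close>

definition chain_sigma ::
    "nat \<Rightarrow> int \<Rightarrow> (int \<Rightarrow> 'a::field_gcd poly poly) \<Rightarrow> (int \<Rightarrow> 'a poly poly) \<Rightarrow> 'a poly poly" where
  "chain_sigma x i \<delta> \<epsilon> = chain_pi x i \<delta> \<epsilon> div chain_pi x (i - 1) \<delta> \<epsilon>"

text \<open>The sequence $(d(\sigma_y), \ldots, d(\sigma_1))$.\<close>

definition sigma_degrees ::
    "nat \<Rightarrow> nat \<Rightarrow> (int \<Rightarrow> 'a::field_gcd poly poly) \<Rightarrow> (int \<Rightarrow> 'a poly poly) \<Rightarrow> nat list" where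
  "sigma_degrees x y \<delta> \<epsilon> = map (\<lambda>i. total_degree (chain_sigma x i \<delta> \<epsilon>)) (rev [1..int y])"


section \<open>Partitions\<close>

text \<open>Partitions are non-increasing lists; list positions are counted from 0.\<close>

definition is_partition :: "nat \<Rightarrow> nat list \<Rightarrow> bool" where
  "is_partition n a \<longleftrightarrow> length a = n \<and> sorted_wrt (\<ge>) a"

definition desc :: "nat list \<Rightarrow> nat list" where
  "desc a = rev (sort a)"

definition entry :: "nat list \<Rightarrow> nat \<Rightarrow> nat" where
  "entry a i = (if i < length a then a ! i else 0)"

text \<open>Only meaningful if \<open>b\<close> is entrywise bounded by \<open>a\<close>.\<close>

definition part_diff :: "nat list \<Rightarrow> nat list \<Rightarrow> nat list" where
  "part_diff a b = desc (map (\<lambda>i. entry a i - entry b i) [0..<max (length a) (length b)])"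

definition part_sum :: "nat list \<Rightarrow> nat list \<Rightarrow> nat list" where
  "part_sum a b = map (\<lambda>i. entry a i + entry b i) [0..<max (length a) (length b)]"

definition part_union :: "nat list \<Rightarrow> nat list \<Rightarrow> nat list" where
  "part_union a b = desc (filter (\<lambda>x. x \<noteq> 0) (a @ b))"

definition part_Union :: "nat list list \<Rightarrow> nat list" where
  "part_Union as = foldr part_union as []"

text \<open>
  Majorization. Lists of different lengths need no explicit padding by zeros: \<open>take\<close> returns the
  whole list when \<open>j\<close> exceeds its length, and appended zeros would not change the sums.
\<close>

definition majorized :: "nat list \<Rightarrow> nat list \<Rightarrow> bool"  (infix \<open>\<prec>\<close> 50) where
  "a \<prec> b \<longleftrightarrow>
     sum_list a = sum_list b \<and>
     (\<forall>j\<in>{1..<max (length a) (length b)}.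
        sum_list (take j (desc a)) \<le> sum_list (take j (desc b)))"

end

theory Submission
  imports Defs
begin

text \<open>
  Over an algebraically closed field a monic homogeneous polynomial is a product of linear forms, hence
  a finite multiset of points of the projective line, and a chain becomes, at every point \<open>P\<close>, a
  non-decreasing sequence of multiplicities. Let \<open>profile\<close> be the conjugate partition of this sequence,
  with parts \<open>t\<^sub>k\<close> for $\alpha$ and \<open>d\<^sub>k\<close> for $\gamma$. Then interlacing means
  \<open>t\<^sub>k \<le> d\<^sub>k \<le> t\<^sub>k + y\<close>, and the exponent of \<open>P\<close> in $\pi_i$ is the sum over \<open>k\<close> of
  \<open>max t\<^sub>k (d\<^sub>k - (y - i))\<close>, so that the degrees of the $\sigma_i$ form the partition conjugate to the
  multiset of all differences \<open>d\<^sub>k - t\<^sub>k\<close> over all points. Since conjugation reverses majorization and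
  turns unions into sums, each of the two statements is the conjugate of the other, with \<open>A\<close> and \<open>B\<close>
  conjugate to the partitions \<open>(c\<^sub>i + 1)\<close> and \<open>(r\<^sub>i + 1)\<close>.
\<close>

section \<open>Homogeneous forms and multisets of points\<close>

text \<open>Zero is of every degree in this sense, so that linear factors can be multiplied in and
  split off without a case distinction on vanishing.\<close>

definition hom_degree :: "nat \<Rightarrow> 'a::zero poly poly \<Rightarrow> bool" where
  "hom_degree k p \<longleftrightarrow> (\<forall>i j. i + j \<noteq> k \<longrightarrow> coeff (coeff p i) j = 0)"

lemma homogeneous_altdef: "homogeneous p \<longleftrightarrow> (\<exists>k. hom_degree k p)"
  unfolding homogeneous_def hom_degree_def by metis

lemma hom_degreeD: "hom_degree k p \<Longrightarrow> i + j \<noteq> k \<Longrightarrow> coeff (coeff p i) j = 0"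
  by (auto simp: hom_degree_def)

lemma hom_degree_coeff: "hom_degree k p \<Longrightarrow> i \<le> k \<Longrightarrow> coeff p i = monom (coeff (coeff p i) (k - i)) (k - i)"
  by (rule poly_eqI) (auto simp: hom_degree_def)

lemma hom_degree_coeff_eq_0: "hom_degree k p \<Longrightarrow> k < i \<Longrightarrow> coeff p i = 0"
  by (rule poly_eqI) (auto simp: hom_degree_def)

lemma total_degree_eq: 
  assumes "hom_degree k p" "p \<noteq> 0"
  shows "total_degree p = k"
proof -
  have "coeff (coeff p (degree p)) (degree (lead_coeff p)) \<noteq> 0"
    using assms by simp
  moreover from this have "degree p + degree (lead_coeff p) = k"
    using hom_degreeD[OF assms(1)] by blast
  ultimately have "{i + j | i j. coeff (coeff p i) j \<noteq> 0} = {k}"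
    using hom_degreeD[OF assms(1)] by blast
  then show ?thesis
    using assms(2) by (simp add: total_degree_def)
qed

text \<open>The linear form vanishing at a point of the projective line; \<open>None\<close> is the point $\mu = 0$.\<close>

definition lin :: "'a::field option \<Rightarrow> 'a poly poly" where
  "lin P = (case P of None \<Rightarrow> [:[:0, 1:]:] | Some a \<Rightarrow> [:[:0, - a:], 1:])"

lemma coeff_lin_None_mult: "coeff (lin None * p) i = pCons 0 (coeff p i)"
  by (simp add: lin_def)

lemma coeff_lin_Some_mult_0: "coeff (lin (Some a) * p) 0 = pCons 0 (smult (- a) (coeff p 0))"
  by (simp add: lin_def)

lemma coeff_lin_Some_mult_Suc:
  "coeff (lin (Some a) * p) (Suc i) = pCons 0 (smult (- a) (coeff p (Suc i))) + coeff p i"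
  by (simp add: lin_def)

lemma hom_degree_lin_mult: "hom_degree k p \<Longrightarrow> hom_degree (Suc k) (lin P * p)"
  unfolding hom_degree_def
  by (cases P; intro allI; case_tac i)
     (auto simp: coeff_lin_None_mult coeff_lin_Some_mult_0 coeff_lin_Some_mult_Suc coeff_pCons
        split: nat.splits)

lemma hom_degree_lin_multD:
  assumes "hom_degree (Suc k) (lin P * q)"
  shows "hom_degree k q"
proof (cases P)
  case None
  show ?thesis
    unfolding hom_degree_def
  proof (intro allI impI)
    fix i j assume "i + j \<noteq> k"
    then show "coeff (coeff q i) j = 0"
      using hom_degreeD[OF assms, of i "Suc j"] by (simp add: None coeff_lin_None_mult)
  qed
next
  case (Some a)
  have "i + j \<noteq> k \<Longrightarrow> coeff (coeff q i) j = 0" for i j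
  \<comment> \<open>The coefficient of the product at \<lambda>^(i+1) \<mu>^j is that of
    \<open>q\<close> at \<lambda>^i \<mu>^j minus \<open>a\<close> times that of \<open>q\<close> at
    \<lambda>^(i+1) \<mu>^(j-1); hence induction over the power of \<mu>.\<close>
  proof (induction j arbitrary: i)
    case 0
    then show ?case
      using hom_degreeD[OF assms, of "Suc i" 0] by (simp add: Some coeff_lin_Some_mult_Suc)
  next
    case (Suc j)
    then show ?case
      using hom_degreeD[OF assms, of "Suc i" "Suc j"] Suc.IH[of "Suc i"]
      by (simp add: Some coeff_lin_Some_mult_Suc)
  qed
  then show ?thesis
    by (auto simp: hom_degree_def)
qed

lemma lin_nonzero [simp]: "lin P \<noteq> 0"
  by (auto simp: lin_def split: option.splits)

lemma inj_lin: "inj lin"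
  by (rule injI) (auto simp: lin_def split: option.splits)

lemma lead_coeff_lin [simp]: "lead_coeff (lead_coeff (lin P)) = 1"
  by (auto simp: lin_def split: option.splits)

lemma prime_lin: "prime (lin (P :: 'a::field_gcd option))"
proof (rule primeI)
  show "prime_elem (lin P)"
  proof (cases P)
    case None
    then show ?thesis
      by (simp add: lin_def prime_elem_const_poly_iff prime_elem_linear_field_poly)
  next
    case (Some a)
    then show ?thesis
      by (simp add: lin_def prime_elem_linear_poly)
  qed
  show "normalize (lin P) = lin P"
    by (auto simp: lin_def normalize_poly_eq_map_poly map_poly_pCons split: option.splits)
qed

section \<open>Products of linear forms, and factorization into them\<close>

definition form :: "'a::field option multiset \<Rightarrow> 'a poly poly" where
  "form M = prod_mset (image_mset lin M)"

lemma form_empty [simp]: "form {#} = 1"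
  and form_add_mset: "form (add_mset P M) = lin P * form M"
  and form_union: "form (M + N) = form M * form N"
  by (simp_all add: form_def)

lemma form_nonzero [simp]: "form M \<noteq> 0"
  by (induction M) (auto simp: form_add_mset)

lemma hom_degree_form: "hom_degree (size M) (form M)"
  by (induction M)
     (simp_all add: form_add_mset hom_degree_lin_mult, simp add: hom_degree_def coeff_pCons split: nat.splits)

lemma monic2_form: "monic2 (form M)"
  by (induction M) (auto simp: form_add_mset monic2_def lead_coeff_mult)

lemma total_degree_form [simp]: "total_degree (form M) = size M"
  by (simp add: hom_degree_form total_degree_eq)

text \<open>Induction on the degree: a form of positive degree has a zero on the projective line,
  and the linear form of that point splits off. The scalar \<open>c\<close> remains because nothing
  is assumed about leading coefficients here.\<close>

lemma hom_degree_imp_form: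
  fixes p :: "'a::alg_closed_field poly poly"
  assumes "hom_degree k p" "p \<noteq> 0"
  shows "\<exists>c M. p = smult [:c:] (form M)"
  using assms
proof (induction k arbitrary: p)
  case 0
  have "p = [:[:coeff (coeff p 0) 0:]:]"
    using 0 by (intro poly_eqI) (auto simp: hom_degree_def coeff_pCons split: nat.splits)
  then show ?case
    by (intro exI[of _ "coeff (coeff p 0) 0"] exI[of _ "{#}"]) simp
next
  case (Suc k)
  have "\<exists>P. lin P dvd p"
  \<comment> \<open>Without the pure power of \<lambda> every term contains \<mu>, so the point at
    infinity is a zero. With it, setting \<mu> = 1 gives a univariate polynomial of degree
    \<open>Suc k\<close>, which has a root.\<close>
  proof (cases "coeff (coeff p (Suc k)) 0 = 0")
    case True
    then have "coeff (coeff p i) 0 = 0" for i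
      using Suc.prems(1) by (cases "i = Suc k") (auto simp: hom_degree_def)
    then have "[:0, 1:] dvd coeff p i" for i
      using poly_eq_0_iff_dvd[of "coeff p i" 0] by (simp add: poly_0_coeff_0)
    then have "lin None dvd p"
      by (simp add: lin_def const_poly_dvd_iff)
    then show ?thesis ..
  next
    case False
    define u where "u i = coeff (coeff p i) (Suc k - i)" for i
    obtain x where x: "(\<Sum>i\<le>Suc k. u i * x ^ i) = 0"
      using alg_closed[of "Suc k" u] False by (auto simp: u_def)
    have "degree p = Suc k"
      using False hom_degree_coeff_eq_0[OF Suc.prems(1)]
      by (intro antisym degree_le le_degree) auto
    \<comment> \<open>Homogeneity turns the substitution of \<open>x\<close> times \<mu> for
      \<lambda> into the value of the dehomogenized polynomial at \<open>x\<close> times a power of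
      \<mu>, which vanishes by the choice of \<open>x\<close>.\<close>
    then have "poly p [:0, x:] = (\<Sum>i\<le>Suc k. coeff p i * [:0, x:] ^ i)"
      by (simp only: poly_altdef)
    also have "\<dots> = (\<Sum>i\<le>Suc k. monom (u i * x ^ i) (Suc k))"
    proof (intro sum.cong refl)
      fix i assume "i \<in> {..Suc k}"
      moreover from this have "coeff p i = monom (u i) (Suc k - i)"
        unfolding u_def by (intro hom_degree_coeff[OF Suc.prems(1)]) simp
      moreover have "[:0, x:] = monom x 1"
        by (simp add: monom_altdef)
      ultimately show "coeff p i * [:0, x:] ^ i = monom (u i * x ^ i) (Suc k)"
        by (simp add: monom_power mult_monom)
    qed
    also have "\<dots> = monom (\<Sum>i\<le>Suc k. u i * x ^ i) (Suc k)"
      by (rule poly_eqI) (simp add: coeff_sum)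
    finally have "poly p [:0, x:] = 0"
      using x by simp
    then have "lin (Some x) dvd p"
      by (simp add: poly_eq_0_iff_dvd lin_def)
    then show ?thesis ..
  qed
  then obtain P q where q: "p = lin P * q"
    by (auto elim: dvdE)
  then obtain c M where "q = smult [:c:] (form M)"
    using Suc hom_degree_lin_multD by (metis mult_zero_right)
  then have "p = smult [:c:] (form (add_mset P M))"
    by (simp add: q form_add_mset)
  then show ?case
    by blast
qed

lemma homogeneous_monic_iff_form:
  fixes p :: "'a::alg_closed_field poly poly"
  shows "p \<noteq> 0 \<and> homogeneous p \<and> monic2 p \<longleftrightarrow> (\<exists>M. p = form M)"
proof
  assume *: "p \<noteq> 0 \<and> homogeneous p \<and> monic2 p"
  then obtain c M where p: "p = smult [:c:] (form M)"
    using hom_degree_imp_form homogeneous_altdef by metis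
  then have "c = 1"
    using * monic2_form[of M] by (auto simp: monic2_def lead_coeff_mult)
  then show "\<exists>M. p = form M"
    using p by (auto simp flip: one_pCons)
qed (auto simp: homogeneous_altdef monic2_form intro: hom_degree_form)

section \<open>Divisibility and lcm of forms as inclusion and union of multisets\<close>

lemma prime_factorization_form:
  "prime_factorization (form M) = image_mset lin (M :: 'a::field_gcd option multiset)"
  unfolding form_def by (rule prime_factorization_prod_mset_primes) (auto simp: prime_lin)

lemma normalize_form [simp]: "normalize (form (M :: 'a::field_gcd option multiset)) = form M"
  by (induction M) (simp_all add: form_add_mset normalize_mult prime_lin normalize_prime)

lemma image_mset_subseteq_iff:
  assumes "inj f"
  shows "image_mset f M \<subseteq># image_mset f N \<longleftrightarrow> M \<subseteq># N"
proof
  assume "image_mset f M \<subseteq># image_mset f N"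
  then have "image_mset (inv f) (image_mset f M) \<subseteq># image_mset (inv f) (image_mset f N)"
    by (rule image_mset_subseteq_mono)
  then show "M \<subseteq># N"
    by (simp add: multiset.map_comp comp_def assms)
qed (rule image_mset_subseteq_mono)

lemma form_dvd_iff [simp]: "form M dvd form N \<longleftrightarrow> M \<subseteq># (N :: 'a::field_gcd option multiset)"
  by (simp add: prime_factorization_subset_iff_dvd[symmetric] prime_factorization_form
      image_mset_subseteq_iff inj_lin)

lemma count_image_mset_inj: "inj f \<Longrightarrow> count (image_mset f M) (f x) = count M x"
  by (induction M) (auto simp: inj_eq)

lemma image_mset_union_max_inj:
  assumes "inj f"
  shows "image_mset f (M \<union># N) = image_mset f M \<union># image_mset f N"
proof (rule multiset_eqI)
  fix y
  show "count (image_mset f (M \<union># N)) y = count (image_mset f M \<union># image_mset f N) y"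
  proof (cases "y \<in> range f")
    case True
    then show ?thesis
      using assms by (auto simp: count_image_mset_inj)
  next
    case False
    then have "f -` {y} = {}"
      by auto
    then show ?thesis
      by (simp add: count_image_mset)
  qed
qed

text \<open>A common multiple \<open>l\<close> is an arbitrary polynomial and may have prime factors
  other than linear forms, so the universal property is checked on prime factorizations.\<close>

lemma lcm_form: "lcm (form M) (form N) = form (M \<union># (N :: 'a::field_gcd option multiset))"
proof (rule lcmI[symmetric])
  fix l assume "form M dvd l" "form N dvd l"
  show "form (M \<union># N) dvd l"
  proof (cases "l = 0")
    case False
    have "image_mset lin M \<subseteq># prime_factorization l" "image_mset lin N \<subseteq># prime_factorization l"
      using \<open>form M dvd l\<close> \<open>form N dvd l\<close> False
      by (simp_all add: prime_factorization_subset_iff_dvd[symmetric] prime_factorization_form)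
    then have "image_mset lin M \<union># image_mset lin N \<subseteq># prime_factorization l"
      by simp
    then have "image_mset lin (M \<union># N) \<subseteq># prime_factorization l"
      by (metis image_mset_union_max_inj inj_lin)
    then show ?thesis
      using False by (simp add: prime_factorization_subset_iff_dvd[symmetric] prime_factorization_form)
  qed simp
qed simp_all

lemma form_inject [simp]: "form M = form N \<longleftrightarrow> M = (N :: 'a::field_gcd option multiset)"
  by (metis form_dvd_iff dvd_refl subset_mset.antisym)

section \<open>Chains and their profiles\<close>

text \<open>The empty multiset stands for the polynomial 1. The 0 to the right of a chain is no
  product of linear forms; values beyond \<open>x\<close> are left free here and
  \<open>form_chain\<close> puts the 0 there.\<close>

definition point_chain :: "nat \<Rightarrow> (int \<Rightarrow> 'p multiset) \<Rightarrow> bool" where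
  "point_chain x a \<longleftrightarrow> (\<forall>i\<le>0. a i = {#}) \<and> (\<forall>i j. i \<le> j \<longrightarrow> j \<le> int x \<longrightarrow> a i \<subseteq># a j)"

definition form_chain :: "nat \<Rightarrow> (int \<Rightarrow> 'a::field option multiset) \<Rightarrow> int \<Rightarrow> 'a poly poly" where
  "form_chain x a i = (if i \<le> int x then form (a i) else 0)"

lemma hom_chain_form_chain:
  fixes a :: "int \<Rightarrow> 'a::{alg_closed_field, field_gcd} option multiset"
  assumes "point_chain x a"
  shows "hom_chain x (form_chain x a)"
  using assms homogeneous_monic_iff_form[where ?'a = 'a]
  by (auto simp: hom_chain_def form_chain_def point_chain_def)

lemma hom_chain_imp_form_chain:
  fixes \<alpha> :: "int \<Rightarrow> 'a::{alg_closed_field, field_gcd} poly poly"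
  assumes "hom_chain x \<alpha>"
  obtains a where "point_chain x a" "\<alpha> = form_chain x a"
proof -
  have "\<exists>M. i \<le> int x \<longrightarrow> \<alpha> i = form M" for i
  proof (cases "i \<le> 0")
    case True
    then show ?thesis
      using assms by (intro exI[of _ "{#}"]) (simp add: hom_chain_def)
  next
    case False
    then show ?thesis
      using assms homogeneous_monic_iff_form[of "\<alpha> i"] by (auto simp: hom_chain_def)
  qed
  then obtain a where a: "\<And>i. i \<le> int x \<Longrightarrow> \<alpha> i = form (a i)"
    by metis
  have *: "a i = {#}" if "i \<le> 0" for i
  proof -
    have "form (a i) = form {#}"
      using assms a[of i] that by (simp add: hom_chain_def)
    then show ?thesis
      by (simp only: form_inject)
  qed
  have "a i \<subseteq># a j" if "i \<le> j" "j \<le> int x" for i j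
    using that
  proof (induction j rule: int_ge_induct)
    case (step j)
    have "a j \<subseteq># a (j + 1)"
    proof (cases "j \<le> 0")
      case False
      then have "\<alpha> j dvd \<alpha> (j + 1)"
        using assms step.prems by (simp add: hom_chain_def)
      then show ?thesis
        using a[of j] a[of "j + 1"] step.prems by simp
    qed (simp add: *)
    with step show ?case
      using subset_mset.order_trans by fastforce
  qed simp
  then have "point_chain x a"
    using * by (auto simp: point_chain_def)
  moreover have "\<alpha> = form_chain x a"
    using assms a by (auto simp: form_chain_def hom_chain_def)
  ultimately show thesis
    by (rule that)
qed

definition points_interlaced :: "nat \<Rightarrow> nat \<Rightarrow> (int \<Rightarrow> 'p multiset) \<Rightarrow> (int \<Rightarrow> 'p multiset) \<Rightarrow> bool" where
  "points_interlaced x y a e \<longleftrightarrow> (\<forall>i\<in>{1..int x}. e i \<subseteq># a i \<and> a i \<subseteq># e (i + int y))"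

lemma interlaced_form_chain:
  fixes a e :: "int \<Rightarrow> 'a::field_gcd option multiset"
  shows "interlaced x y (form_chain x a) (form_chain (x + y) e) \<longleftrightarrow> points_interlaced x y a e"
  unfolding interlaced_def points_interlaced_def
  by (intro ball_cong refl) (simp add: form_chain_def)

section \<open>Profiles, and interlacing in terms of profiles\<close>

definition profile :: "nat \<Rightarrow> (int \<Rightarrow> 'p multiset) \<Rightarrow> 'p \<Rightarrow> nat \<Rightarrow> nat" where
  "profile x a P k = card {i\<in>{1..int x}. k < count (a i) P}"

lemma profile_le: "profile x a P k \<le> x"
proof -
  have "profile x a P k \<le> card {1..int x}"
    unfolding profile_def by (rule card_mono) (auto intro: finite_subset[of _ "{1..int x}"])
  then show ?thesis by simp
qed

lemma profile_antimono: "k \<le> l \<Longrightarrow> profile x a P l \<le> profile x a P k"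
  unfolding profile_def by (rule card_mono) (auto intro: finite_subset[of _ "{1..int x}"])

lemma point_chain_count_mono:
  "point_chain x a \<Longrightarrow> i \<le> j \<Longrightarrow> j \<le> int x \<Longrightarrow> count (a i) P \<le> count (a j) P"
  by (auto simp: point_chain_def intro: mset_subset_eq_count)

text \<open>Multiplicities do not decrease along the chain, so the indices with multiplicity above
  \<open>k\<close> form a final segment of \<open>{1..int x}\<close>; \<open>i\<close> lies in it
  iff fewer indices follow \<open>i\<close> than the segment has elements.\<close>

lemma less_profile_iff:
  assumes "point_chain x a" "i \<in> {1..int x}"
  shows "k < count (a i) P \<longleftrightarrow> int x - i < int (profile x a P k)"
proof
  assume "k < count (a i) P"
  then have "{i..int x} \<subseteq> {i\<in>{1..int x}. k < count (a i) P}"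
    using assms point_chain_count_mono[OF assms(1), of i] by (fastforce intro: less_le_trans)
  then have "card {i..int x} \<le> profile x a P k"
    unfolding profile_def
    by (intro card_mono) (auto intro: finite_subset[of _ "{1..int x}"])
  then show "int x - i < int (profile x a P k)"
    using assms(2) by simp
next
  assume *: "int x - i < int (profile x a P k)"
  show "k < count (a i) P"
  proof (rule ccontr)
    assume "\<not> k < count (a i) P"
    then have "i < l" if "k < count (a l) P" for l
      using assms(2) point_chain_count_mono[OF assms(1), of l i P] that by force
    then have "{i\<in>{1..int x}. k < count (a i) P} \<subseteq> {i<..int x}"
      by auto
    then have "profile x a P k \<le> card {i<..int x}"
      unfolding profile_def by (intro card_mono) auto
    then have "int (profile x a P k) \<le> int x - i"
      using assms(2) by (simp add: le_nat_iff)
    with * show False by simp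
  qed
qed

text \<open>Level by level, inclusions of multisets compare final segments. The two chains end at
  \<open>x\<close> and at \<open>x + y\<close>, so the inclusion of \<open>e i\<close> in
  \<open>a i\<close> costs a shift by \<open>y\<close>, while that of \<open>a i\<close> in
  \<open>e (i + y)\<close> costs none.\<close>

lemma points_interlaced_iff_profile:
  assumes a: "point_chain x a" and e: "point_chain (x + y) e"
  shows "points_interlaced x y a e \<longleftrightarrow>
    (\<forall>P k. profile x a P k \<le> profile (x + y) e P k \<and> profile (x + y) e P k \<le> profile x a P k + y)"
proof
  assume L: "points_interlaced x y a e"
  show "\<forall>P k. profile x a P k \<le> profile (x + y) e P k \<and> profile (x + y) e P k \<le> profile x a P k + y"
  proof (intro allI conjI)
    fix P k
    show "profile x a P k \<le> profile (x + y) e P k"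
    proof (cases "profile x a P k = 0")
      case False
      \<comment> \<open>The first index at which the multiplicity in \<open>a\<close> exceeds
        \<open>k\<close>.\<close>
      define i where "i = int x - int (profile x a P k) + 1"
      have i: "i \<in> {1..int x}"
        using False profile_le[of x a P k] by (simp add: i_def)
      then have "k < count (a i) P"
        using less_profile_iff[OF a i, of k P] by (simp add: i_def)
      also have "\<dots> \<le> count (e (i + int y)) P"
        using L i by (auto simp: points_interlaced_def intro: mset_subset_eq_count)
      finally have "int (x + y) - (i + int y) < profile (x + y) e P k"
        using i by (subst (asm) less_profile_iff[OF e]) auto
      then show ?thesis
        by (simp add: i_def)
    qed simp
    show "profile (x + y) e P k \<le> profile x a P k + y"
    proof (rule ccontr)
      assume *: "\<not> profile (x + y) e P k \<le> profile x a P k + y"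
      \<comment> \<open>The last index at which the multiplicity in \<open>a\<close> is still at
        most \<open>k\<close>; the assumption keeps it at least 1.\<close>
      define i where "i = int x - int (profile x a P k)"
      have i: "i \<in> {1..int x}"
        using * profile_le[of "x + y" e P k] by (simp add: i_def)
      then have "k < count (e i) P"
        using * less_profile_iff[OF e, of i k P] by (simp add: i_def)
      also have "\<dots> \<le> count (a i) P"
        using L i by (auto simp: points_interlaced_def intro: mset_subset_eq_count)
      finally show False
        using i by (subst (asm) less_profile_iff[OF a]) (auto simp: i_def)
    qed
  qed
next
  assume R: "\<forall>P k. profile x a P k \<le> profile (x + y) e P k \<and> profile (x + y) e P k \<le> profile x a P k + y"
  show "points_interlaced x y a e"
    unfolding points_interlaced_def
  proof (intro ballI conjI mset_subset_eqI leI notI)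
    fix i P assume i: "i \<in> {1..int x}"
    {
      \<comment> \<open>In both cases the level is the multiplicity that is too small, which would
        then exceed itself.\<close>
      assume "count (a i) P < count (e i) P"
      then have "int (x + y) - i < profile (x + y) e P (count (a i) P)"
        using i by (subst (asm) less_profile_iff[OF e]) auto
      also have "\<dots> \<le> profile x a P (count (a i) P) + y"
        using R by (simp flip: of_nat_add)
      finally have "count (a i) P < count (a i) P"
        using i by (subst less_profile_iff[OF a]) auto
      then show False by simp
    next
      let ?c = "count (e (i + int y)) P"
      assume "?c < count (a i) P"
      then have "int x - i < profile x a P ?c"
        using i by (subst (asm) less_profile_iff[OF a]) auto
      also have "\<dots> \<le> profile (x + y) e P ?c"
        using R by simp
      finally have "?c < ?c"
        using i by (subst less_profile_iff[OF e]) auto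
      then show False by simp
    }
  qed
qed

section \<open>Chains with prescribed profiles\<close>

definition realize :: "'p set \<Rightarrow> nat \<Rightarrow> nat \<Rightarrow> ('p \<Rightarrow> nat \<Rightarrow> nat) \<Rightarrow> int \<Rightarrow> 'p multiset" where
  "realize S s x F i =
    (if i \<le> 0 then {#} else \<Sum>P\<in>S. replicate_mset (card {k. k < s \<and> int x - i < int (F P k)}) P)"

lemma count_realize:
  assumes "finite S"
  shows "count (realize S s x F i) P =
    (if i \<le> 0 \<or> P \<notin> S then 0 else card {k. k < s \<and> int x - i < int (F P k)})"
  using assms by (auto simp: realize_def count_sum sum.delta if_distrib cong: if_cong)

lemma point_chain_realize:
  assumes "finite S"
  shows "point_chain x (realize S s x F)"
  unfolding point_chain_def
proof (intro conjI allI impI mset_subset_eqI)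
  fix i j :: int and P assume "i \<le> j"
  then have "card {k. k < s \<and> int x - i < int (F P k)} \<le> card {k. k < s \<and> int x - j < int (F P k)}"
    by (intro card_mono) auto
  then show "count (realize S s x F i) P \<le> count (realize S s x F j) P"
    using \<open>i \<le> j\<close> by (simp add: count_realize assms)
qed (simp add: realize_def)

text \<open>\<open>realize\<close> conjugates the sequences \<open>F P\<close> back, and conjugation
  is an involution: as \<open>F P\<close> does not increase, the levels counted at index
  \<open>i\<close> form an initial segment, so \<open>k\<close> is below their number iff it is one
  of them. The bound by \<open>x\<close> leaves room for \<open>F P k\<close> indices.\<close>

lemma profile_realize:
  assumes "finite S" "P \<in> S" "\<And>k l. k \<le> l \<Longrightarrow> l < s \<Longrightarrow> F P l \<le> F P k" "\<And>k. k < s \<Longrightarrow> F P k \<le> x"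
    and "k < s"
  shows "profile x (realize S s x F) P k = F P k"
proof -
  have "k < card {k. k < s \<and> int x - i < int (F P k)} \<longleftrightarrow> int x - i < int (F P k)" for i :: int
  proof
    assume *: "int x - i < int (F P k)"
    have "{..k} \<subseteq> {k. k < s \<and> int x - i < int (F P k)}"
      using assms(3)[of _ k] assms(5) * by (auto; fastforce)
    then have "card {..k} \<le> card {k. k < s \<and> int x - i < int (F P k)}"
      by (intro card_mono) auto
    then show "k < card {k. k < s \<and> int x - i < int (F P k)}"
      by simp
  next
    assume *: "k < card {k. k < s \<and> int x - i < int (F P k)}"
    show "int x - i < int (F P k)"
    proof (rule ccontr)
      assume "\<not> int x - i < int (F P k)"
      then have "\<not> int x - i < int (F P l)" if "k \<le> l" "l < s" for l
        using assms(3)[OF that] by linarith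
      then have "{k. k < s \<and> int x - i < int (F P k)} \<subseteq> {..<k}"
        using leI by auto
      then have "card {k. k < s \<and> int x - i < int (F P k)} \<le> card {..<k}"
        by (intro card_mono) auto
      with * show False by simp
    qed
  qed
  then have "profile x (realize S s x F) P k = card {i\<in>{1..int x}. int x - i < int (F P k)}"
    unfolding profile_def using assms(1,2) by (intro arg_cong[where f = card]) (auto simp: count_realize)
  also have "{i\<in>{1..int x}. int x - i < int (F P k)} = {int x - int (F P k) + 1..int x}"
    using assms(4)[OF \<open>k < s\<close>] by auto
  finally show ?thesis by simp
qed

section \<open>The degrees of the \<sigma>_i as a conjugate partition\<close>

definition conjugate :: "nat \<Rightarrow> nat multiset \<Rightarrow> nat list" where
  "conjugate y W = map (\<lambda>j. size (filter_mset (\<lambda>w. j < w) W)) [0..<y]"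

text \<open>\<open>S\<close> and \<open>{..<s}\<close> form the window of points and levels outside
  of which all profiles vanish.\<close>

definition bounded_chain :: "'p set \<Rightarrow> nat \<Rightarrow> nat \<Rightarrow> (int \<Rightarrow> 'p multiset) \<Rightarrow> bool" where
  "bounded_chain S s x a \<longleftrightarrow> (\<forall>i\<le>int x. (\<forall>P. count (a i) P \<le> s) \<and> set_mset (a i) \<subseteq> S)"

lemma bounded_chain_lower:
  assumes "points_interlaced x y a e" "point_chain x a" "bounded_chain S s (x + y) e"
  shows "bounded_chain S s x a"
  unfolding bounded_chain_def
proof (intro allI impI)
  fix i assume i: "i \<le> int x"
  have "a i \<subseteq># e (i + int y)"
    using assms(1,2) i by (cases "i \<le> 0") (auto simp: point_chain_def points_interlaced_def)
  moreover have "i + int y \<le> int (x + y)"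
    using i by simp
  then have "\<forall>P. count (e (i + int y)) P \<le> s" "set_mset (e (i + int y)) \<subseteq> S"
    using assms(3) unfolding bounded_chain_def by blast+
  ultimately show "(\<forall>P. count (a i) P \<le> s) \<and> set_mset (a i) \<subseteq> S"
    by (meson mset_subset_eq_count order_trans set_mset_mono)
qed

definition pi_points :: "nat \<Rightarrow> nat \<Rightarrow> (int \<Rightarrow> 'p multiset) \<Rightarrow> (int \<Rightarrow> 'p multiset) \<Rightarrow> 'p multiset" where
  "pi_points x u a e = (\<Sum>j\<in>{1..int x + int u}. a (j - int u) \<union># e j)"

lemma form_sum: "finite A \<Longrightarrow> form (\<Sum>i\<in>A. M i) = (\<Prod>i\<in>A. form (M i))"
  by (induction A rule: finite_induct) (simp_all add: form_union)

lemma chain_pi_form_chain: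
  fixes a e :: "int \<Rightarrow> 'a::field_gcd option multiset"
  assumes "u \<le> y"
  shows "chain_pi x (int u) (form_chain x a) (form_chain (x + y) e) = form (pi_points x u a e)"
  unfolding chain_pi_def pi_points_def form_sum[OF finite_atLeastAtMost_int]
  using assms by (intro prod.cong refl) (simp add: form_chain_def lcm_form)

text \<open>At each level the indices \<open>j\<close> where \<open>a (j - u)\<close> or
  \<open>e j\<close> exceeds the level form the longer of two final segments of
  \<open>{1..x + u}\<close>. The segment of \<open>e\<close> ends at \<open>x + y\<close>; cutting
  it off at \<open>x + u\<close> removes \<open>y - u\<close> indices, or all of it, hence the
  truncated subtraction.\<close>

lemma count_pi_points:
  assumes a: "point_chain x a" "bounded_chain S s x a"
    and e: "point_chain (x + y) e" "bounded_chain S s (x + y) e"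
    and u: "u \<le> y"
  shows "count (pi_points x u a e) P =
    (\<Sum>k<s. max (profile x a P k) (profile (x + y) e P k - (y - u)))"
proof -
  let ?J = "{1..int x + int u}"
  have le_s: "count (a (j - int u)) P \<le> s" "count (e j) P \<le> s" if "j \<in> ?J" for j
    using a(2) e(2) u that by (auto simp: bounded_chain_def)
  have "count (pi_points x u a e) P = (\<Sum>j\<in>?J. max (count (a (j - int u)) P) (count (e j) P))"
    by (simp add: pi_points_def count_sum)
  also have "\<dots> = (\<Sum>j\<in>?J. card {k\<in>{..<s}. k < count (a (j - int u)) P \<or> k < count (e j) P})"
  proof (intro sum.cong refl)
    fix j assume "j \<in> ?J"
    then have "{k\<in>{..<s}. k < count (a (j - int u)) P \<or> k < count (e j) P}
        = {..<max (count (a (j - int u)) P) (count (e j) P)}"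
      using le_s by fastforce
    then show "max (count (a (j - int u)) P) (count (e j) P)
        = card {k\<in>{..<s}. k < count (a (j - int u)) P \<or> k < count (e j) P}"
      by simp
  qed
  \<comment> \<open>Double counting of the pairs of an index and a level below the multiplicity
    there.\<close>
  also have "\<dots> = (\<Sum>k<s. card {j\<in>?J. k < count (a (j - int u)) P \<or> k < count (e j) P})"
    by (rule sum_multicount_gen) auto
  also have "\<dots> = (\<Sum>k<s. max (profile x a P k) (profile (x + y) e P k - (y - u)))"
  proof (intro sum.cong refl)
    fix k
    let ?t = "profile x a P k" and ?d = "profile (x + y) e P k"
    have td: "?t \<le> x" "?d \<le> x + y"
      by (rule profile_le)+
    have 1: "k < count (a (j - int u)) P \<longleftrightarrow> int x + int u - j < int ?t" if "j \<in> ?J" for j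
    proof (cases "j \<le> int u")
      \<comment> \<open>Here \<open>j - u\<close> is at most 0, where the chain is empty; the
        right-hand side fails too because the profile is at most \<open>x\<close>.\<close>
      case True
      then show ?thesis
        using a(1) td by (simp add: point_chain_def)
    next
      case False
      then show ?thesis
        using less_profile_iff[OF a(1), of "j - int u" k P] that by (simp add: algebra_simps)
    qed
    have 2: "k < count (e j) P \<longleftrightarrow> int x + int y - j < int ?d" if "j \<in> ?J" for j
      using less_profile_iff[OF e(1), of j k P] that u by (simp add: algebra_simps)
    have "{j\<in>?J. k < count (a (j - int u)) P \<or> k < count (e j) P}
        = {j\<in>?J. int x + int u - j < int ?t \<or> int x + int y - j < int ?d}"
      using 1 2 by blast
    also have "\<dots> = {int x + int u - int (max ?t (?d - (y - u))) + 1..int x + int u}"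
      using u td by auto
    finally show "card {j\<in>?J. k < count (a (j - int u)) P \<or> k < count (e j) P}
        = max ?t (?d - (y - u))"
      by simp
  qed
  finally show ?thesis .
qed

definition profile_diffs ::
    "'p set \<Rightarrow> nat \<Rightarrow> nat \<Rightarrow> nat \<Rightarrow> (int \<Rightarrow> 'p multiset) \<Rightarrow> (int \<Rightarrow> 'p multiset) \<Rightarrow> nat multiset" where
  "profile_diffs S s x y a e =
    image_mset (\<lambda>(P, k). profile (x + y) e P k - profile x a P k) (mset_set (S \<times> {..<s}))"

lemma total_degree_form_div:
  assumes "N \<subseteq># (M :: 'a::field_gcd option multiset)"
  shows "total_degree (form M div form N) = size M - size N"
proof -
  have "form M = form N * form (M - N)"
    using assms by (simp flip: form_union)
  then show ?thesis
    using assms by (simp add: size_Diff_submset)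
qed

text \<open>From one \<open>pi_points\<close> to the next, the maximum belonging to a point and a
  level grows by one exactly if the difference of the profiles exceeds \<open>j\<close>, and is
  unchanged otherwise. The degree of the quotient therefore counts these pairs.\<close>

lemma sigma_degree_form_chain:
  fixes a e :: "int \<Rightarrow> 'a::field_gcd option multiset"
  assumes S: "finite S"
    and a: "point_chain x a" and e: "point_chain (x + y) e" "bounded_chain S s (x + y) e"
    and ae: "points_interlaced x y a e"
    and j: "j < y"
  shows "total_degree (chain_sigma x (int (y - j)) (form_chain x a) (form_chain (x + y) e))
    = size (filter_mset (\<lambda>w. j < w) (profile_diffs S s x y a e))"
proof -
  define u where "u = y - Suc j"
  have u: "Suc u \<le> y" "u \<le> y" "y - Suc u = j" "y - u = Suc j" "y - j = Suc u"
    using j by (simp_all add: u_def)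
  note a' = bounded_chain_lower[OF ae a e(2)]
  define N M where "N = pi_points x u a e" and "M = pi_points x (Suc u) a e"
  let ?t = "profile x a" and ?d = "profile (x + y) e"
  have N: "count N P = (\<Sum>k<s. max (?t P k) (?d P k - Suc j))" for P
    unfolding N_def using count_pi_points[OF a a' e u(2)] by (simp only: u(4))
  have M: "count M P = (\<Sum>k<s. max (?t P k) (?d P k - j))" for P
    unfolding M_def using count_pi_points[OF a a' e u(1)] by (simp only: u(3))
  have "N \<subseteq># M"
    by (rule mset_subset_eqI) (auto simp: N M intro!: sum_mono)
  \<comment> \<open>Confines the supports to the finite set \<open>S\<close>, so that both sizes are
    sums over the same points.\<close>
  have "set_mset M \<subseteq> S"
  proof
    fix P assume "P \<in># M"
    then obtain i where i: "i \<in> {1..int x + int (Suc u)}" "P \<in># a (i - int (Suc u)) \<union># e i"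
      by (auto simp: M_def pi_points_def set_mset_sum)
    moreover have "i - int (Suc u) \<le> int x" "i \<le> int (x + y)"
      using i(1) u(1) by auto
    then have "set_mset (a (i - int (Suc u))) \<subseteq> S" "set_mset (e i) \<subseteq> S"
      using a' e(2) unfolding bounded_chain_def by blast+
    ultimately show "P \<in> S"
      by auto
  qed
  moreover have "set_mset N \<subseteq> set_mset M"
    using \<open>N \<subseteq># M\<close> by (rule set_mset_mono)
  ultimately have size: "size M = (\<Sum>P\<in>S. count M P)" "size N = (\<Sum>P\<in>S. count N P)"
    using S by (auto simp: size_multiset_overloaded_eq count_eq_zero_iff intro!: sum.mono_neutral_left)
  have "max (?t P k) (?d P k - j) = max (?t P k) (?d P k - Suc j) + of_bool (j < ?d P k - ?t P k)" for P k
    by auto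
  then have "size M = size N + (\<Sum>P\<in>S. \<Sum>k<s. of_bool (j < ?d P k - ?t P k))"
    by (simp add: size M N sum.distrib)
  also have "(\<Sum>P\<in>S. \<Sum>k<s. of_bool (j < ?d P k - ?t P k))
      = (\<Sum>z\<in>S \<times> {..<s}. of_bool (j < ?d (fst z) (snd z) - ?t (fst z) (snd z)))"
    by (simp add: sum.cartesian_product case_prod_beta)
  also have "\<dots> = card ((S \<times> {..<s}) \<inter> {z. j < ?d (fst z) (snd z) - ?t (fst z) (snd z)})"
    using S by (simp only: sum_of_bool_eq finite_cartesian_product finite_lessThan of_nat_id)
  also have "\<dots> = size (filter_mset (\<lambda>w. j < w) (profile_diffs S s x y a e))"
    using S by (simp add: profile_diffs_def filter_mset_image_mset filter_mset_mset_set case_prod_beta Int_def)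
  finally have "size (filter_mset (\<lambda>w. j < w) (profile_diffs S s x y a e)) = size M - size N"
    by linarith
  also have "\<dots> = total_degree (form M div form N)"
    using \<open>N \<subseteq># M\<close> by (simp add: total_degree_form_div)
  also have "\<dots> = total_degree (chain_sigma x (int (y - j)) (form_chain x a) (form_chain (x + y) e))"
    unfolding chain_sigma_def u(5) M_def N_def
      chain_pi_form_chain[OF u(1), of x a e, symmetric] chain_pi_form_chain[OF u(2), of x a e, symmetric]
    by simp
  finally show ?thesis by simp
qed

lemma sigma_degrees_form_chain:
  fixes a e :: "int \<Rightarrow> 'a::field_gcd option multiset"
  assumes "finite S" "point_chain x a" "point_chain (x + y) e" "bounded_chain S s (x + y) e"
    and "points_interlaced x y a e"
  shows "sigma_degrees x y (form_chain x a) (form_chain (x + y) e)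
    = conjugate y (profile_diffs S s x y a e)"
proof (rule nth_equalityI)
  fix j assume "j < length (sigma_degrees x y (form_chain x a) (form_chain (x + y) e))"
  then have j: "j < y"
    by (simp add: sigma_degrees_def)
  \<comment> \<open>The list starts with \<sigma>_y, and position \<open>j\<close> counted from 0
    belongs to index \<open>y - j\<close>.\<close>
  then have "rev [1..int y] ! j = int (y - j)"
    by (simp add: rev_nth nth_upto of_nat_diff)
  then show "sigma_degrees x y (form_chain x a) (form_chain (x + y) e) ! j
      = conjugate y (profile_diffs S s x y a e) ! j"
    using j sigma_degree_form_chain[OF assms j]
    by (simp only: sigma_degrees_def conjugate_def nth_map length_rev length_upto length_upt
        nth_upt) simp
qed (simp add: sigma_degrees_def conjugate_def)

section \<open>Conjugation and majorization\<close>

lemma mset_desc [simp]: "mset (desc a) = mset a"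
  by (simp add: desc_def)

lemma length_desc [simp]: "length (desc a) = length a"
  by (simp add: desc_def)

lemma sum_list_desc [simp]: "sum_list (desc a) = sum_list a"
  by (metis mset_desc sum_mset_sum_list)

lemma sorted_desc: "sorted_wrt (\<ge>) (desc a)"
  by (simp add: desc_def sorted_wrt_rev)

lemma desc_sorted: "sorted_wrt (\<ge>) a \<Longrightarrow> desc a = a"
  unfolding desc_def by (metis mset_rev properties_for_sort rev_rev_ident sorted_wrt_rev)

section \<open>Majorization through top sums and capped sums\<close>

definition top_sum :: "nat list \<Rightarrow> nat \<Rightarrow> nat" where
  "top_sum a h = sum_list (take h (desc a))"

text \<open>In the Young diagram with rows \<open>M\<close> this counts the cells of the first
  \<open>h\<close> columns, so it is the counterpart of \<open>top_sum\<close> under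
  conjugation.\<close>

definition capped_sum :: "nat multiset \<Rightarrow> nat \<Rightarrow> nat" where
  "capped_sum M h = (\<Sum>x\<in>#M. min x h)"

text \<open>Outside the range of \<open>j\<close> in \<open>majorized\<close>, both sums are empty
  or both are the total sums.\<close>

lemma majorized_iff_top_sum: "a \<prec> b \<longleftrightarrow> sum_list a = sum_list b \<and> (\<forall>h. top_sum a h \<le> top_sum b h)"
proof -
  have "top_sum a h \<le> top_sum b h"
    if *: "sum_list a = sum_list b" and "h \<notin> {1..<max (length a) (length b)}" for h
  proof -
    have "h = 0 \<or> length a \<le> h \<and> length b \<le> h"
      using that(2) by auto
    then show ?thesis
      using * by (auto simp: top_sum_def)
  qed
  then show ?thesis
    unfolding majorized_def top_sum_def by blast
qed

text \<open>Entry by entry: a taken entry \<open>x\<close> contributes \<open>x + min x h\<close>,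
  at most \<open>h + x\<close>; any other contributes \<open>min x h\<close>, at most
  \<open>x\<close>.\<close>

lemma capped_top_le: "sum_list (take j a) + capped_sum (mset a) h \<le> h * j + sum_list a"
proof (induction a arbitrary: j)
  case Nil
  then show ?case by (simp add: capped_sum_def)
next
  case (Cons x a)
  show ?case
  proof (cases j)
    case 0
    then show ?thesis
      using Cons[of 0] by (simp add: capped_sum_def)
  next
    case (Suc i)
    then show ?thesis
      using Cons[of i] by (simp add: capped_sum_def)
  qed
qed

lemma capped_sum_eq_sum_list: "(\<And>x. x \<in> set a \<Longrightarrow> x \<le> h) \<Longrightarrow> capped_sum (mset a) h = sum_list a"
  by (induction a) (auto simp: capped_sum_def)

text \<open>Equality holds if exactly the entries above \<open>h\<close> are taken.\<close>

lemma capped_top_attained_position: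
  "sorted_wrt (\<ge>) a \<Longrightarrow> \<exists>j. sum_list (take j a) + capped_sum (mset a) h = h * j + sum_list a"
proof (induction a)
  case Nil
  then show ?case by (intro exI[of _ 0]) (simp add: capped_sum_def)
next
  case (Cons x a)
  show ?case
  proof (cases "h < x")
    case True
    obtain j where "sum_list (take j a) + capped_sum (mset a) h = h * j + sum_list a"
      using Cons by auto
    then show ?thesis
      using True by (intro exI[of _ "Suc j"]) (simp add: capped_sum_def)
  next
    case False
    have "capped_sum (mset (x # a)) h = sum_list (x # a)"
      by (rule capped_sum_eq_sum_list) (use False Cons.prems in auto)
    then show ?thesis
      by (intro exI[of _ 0]) simp
  qed
qed

text \<open>The height is the entry following the first \<open>j\<close>, or 0 beyond the end of the
  list. The bound on \<open>h\<close> strengthens the induction: it puts \<open>h\<close> below the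
  new head, whose capped value is then \<open>h\<close>.\<close>

lemma capped_top_attained_height:
  "sorted_wrt (\<ge>) a \<Longrightarrow>
    \<exists>h. (\<forall>x. (\<forall>y\<in>set a. y \<le> x) \<longrightarrow> h \<le> x) \<and>
      sum_list (take j a) + capped_sum (mset a) h = h * j + sum_list a"
proof (induction a arbitrary: j)
  case Nil
  then show ?case by (intro exI[of _ 0]) (simp add: capped_sum_def)
next
  case (Cons x a)
  show ?case
  proof (cases j)
    case 0
    have "capped_sum (mset (x # a)) x = sum_list (x # a)"
      by (rule capped_sum_eq_sum_list) (use Cons.prems in auto)
    then show ?thesis
      using 0 by (intro exI[of _ x]) simp
  next
    case (Suc i)
    obtain h where h: "\<forall>x. (\<forall>y\<in>set a. y \<le> x) \<longrightarrow> h \<le> x"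
        "sum_list (take i a) + capped_sum (mset a) h = h * i + sum_list a"
      using Cons.IH[of i] Cons.prems by auto
    have "h \<le> x"
      using h(1) Cons.prems by auto
    then show ?thesis
      using h Suc by (intro exI[of _ h]) (auto simp: capped_sum_def)
  qed
qed

text \<open>Legendre duality: \<open>capped_sum\<close> is the pointwise minimum over \<open>j\<close> of
  \<open>h * j\<close> plus the sum of all but the \<open>j\<close> largest entries, and conversely.\<close>

lemma majorized_iff_capped_sum:
  "a \<prec> b \<longleftrightarrow> sum_list a = sum_list b \<and> (\<forall>h. capped_sum (mset b) h \<le> capped_sum (mset a) h)"
proof -
  have le: "top_sum c j + capped_sum (mset c) h \<le> h * j + sum_list c" for c j h
    using capped_top_le[of j "desc c" h] by (simp add: top_sum_def)
  have ex1: "\<exists>j. top_sum c j + capped_sum (mset c) h = h * j + sum_list c" for c h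
    using capped_top_attained_position[OF sorted_desc, of c h] by (simp add: top_sum_def)
  have ex2: "\<exists>h. top_sum c j + capped_sum (mset c) h = h * j + sum_list c" for c j
    using capped_top_attained_height[OF sorted_desc, of c j] by (auto simp: top_sum_def)
  show ?thesis
    unfolding majorized_iff_top_sum
  proof (intro conj_cong refl iffI allI)
    fix h assume "sum_list a = sum_list b" "\<forall>h. top_sum a h \<le> top_sum b h"
    \<comment> \<open>The position attaining the minimum for \<open>a\<close> still gives an upper
      bound for \<open>b\<close>; the converse argues likewise with a height attained for
      \<open>b\<close>.\<close>
    moreover obtain j where "top_sum a j + capped_sum (mset a) h = h * j + sum_list a"
      using ex1 by blast
    ultimately show "capped_sum (mset b) h \<le> capped_sum (mset a) h"
      using le[of b j h] by (metis add_le_cancel_left add_mono_thms_linordered_semiring(3) order_trans)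
  next
    fix j assume "sum_list a = sum_list b" "\<forall>h. capped_sum (mset b) h \<le> capped_sum (mset a) h"
    moreover obtain h where "top_sum b j + capped_sum (mset b) h = h * j + sum_list b"
      using ex2 by blast
    ultimately show "top_sum a j \<le> top_sum b j"
      using le[of a j h] by (metis add_le_cancel_right add_mono_thms_linordered_semiring(2) order_trans)
  qed
qed

text \<open>Capping at \<open>N\<close> leaves the sum of \<open>b\<close> unchanged but would
  strictly lower that of \<open>a\<close> if an entry exceeded \<open>N\<close>, against the
  inequality between capped sums.\<close>

lemma majorized_bound:
  assumes "a \<prec> b" "\<And>x. x \<in> set b \<Longrightarrow> x \<le> N" "x \<in> set a"
  shows "x \<le> N"
proof (rule ccontr)
  assume "\<not> x \<le> N"
  obtain M where M: "mset a = add_mset x M"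
    using assms(3) by (metis insert_DiffM set_mset_mset)
  have "sum_list a = sum_list b"
    using assms(1) by (simp add: majorized_def)
  also have "\<dots> = capped_sum (mset b) N"
    using assms(2) by (simp add: capped_sum_eq_sum_list)
  also have "\<dots> \<le> capped_sum (mset a) N"
    using assms(1) by (simp add: majorized_iff_capped_sum)
  also have "\<dots> = N + (\<Sum>x\<in>#M. min x N)"
    using \<open>\<not> x \<le> N\<close> by (simp add: capped_sum_def M)
  also have "(\<Sum>x\<in>#M. min x N) \<le> (\<Sum>x\<in>#M. x)"
    by (rule sum_mset_mono) simp
  finally have "sum_list a \<le> N + sum_mset M"
    by simp
  moreover have "sum_list a = x + sum_mset M"
    by (metis M sum_mset.add_mset sum_mset_sum_list)
  ultimately show False
    using \<open>\<not> x \<le> N\<close> by simp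
qed

section \<open>Conjugate partitions\<close>

lemma length_conjugate [simp]: "length (conjugate y W) = y"
  by (simp add: conjugate_def)

lemma nth_conjugate: "j < y \<Longrightarrow> conjugate y W ! j = size (filter_mset (\<lambda>w. j < w) W)"
  by (simp add: conjugate_def)

lemma is_partition_conjugate: "is_partition y (conjugate y W)"
  unfolding is_partition_def sorted_wrt_iff_nth_less
  by (auto simp: nth_conjugate intro!: size_mset_mono mset_subset_eqI)

lemma sum_size_filter: "(\<Sum>j<h. size (filter_mset (\<lambda>w. j < w) W)) = capped_sum W h"
proof (induction W)
  case empty
  then show ?case by (simp add: capped_sum_def)
next
  case (add w W)
  have "(\<Sum>j<h. size (filter_mset (\<lambda>w. j < w) (add_mset w W)))
      = (\<Sum>j<h. of_bool (j < w) + size (filter_mset (\<lambda>w. j < w) W))"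
    by (intro sum.cong) auto
  also have "\<dots> = card ({..<h} \<inter> {j. j < w}) + capped_sum W h"
    by (simp add: sum.distrib add.IH)
  also have "{..<h} \<inter> {j. j < w} = {..<min w h}"
    by auto
  finally show ?case
    by (simp add: capped_sum_def)
qed

text \<open>Since no member of \<open>W\<close> exceeds \<open>y\<close>, cutting the conjugate to
  \<open>y\<close> parts loses nothing, and its first \<open>h\<close> parts are the first
  \<open>h\<close> columns of the diagram of \<open>W\<close>.\<close>

lemma top_sum_conjugate:
  assumes "\<And>w. w \<in># W \<Longrightarrow> w \<le> y"
  shows "top_sum (conjugate y W) h = capped_sum W h"
proof -
  have "sorted_wrt (\<ge>) (conjugate y W)"
    using is_partition_conjugate by (simp add: is_partition_def)
  then have "top_sum (conjugate y W) h = sum_list (take h (conjugate y W))"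
    by (simp add: top_sum_def desc_sorted)
  also have "\<dots> = (\<Sum>j<min h y. size (filter_mset (\<lambda>w. j < w) W))"
    by (simp add: conjugate_def take_map sum_list_distinct_conv_sum_set atLeast0LessThan min_def)
  also have "\<dots> = capped_sum W (min h y)"
    by (rule sum_size_filter)
  also have "\<dots> = capped_sum W h"
    unfolding capped_sum_def
    by (intro arg_cong[where f = sum_mset] image_mset_cong) (use assms in fastforce)
  finally show ?thesis .
qed

lemma sum_list_conjugate:
  assumes "\<And>w. w \<in># W \<Longrightarrow> w \<le> y"
  shows "sum_list (conjugate y W) = sum_mset W"
proof -
  have "sum_list (conjugate y W) = top_sum (conjugate y W) y"
    by (simp add: top_sum_def)
  also have "\<dots> = (\<Sum>w\<in>#W. min w y)"
    using assms by (simp add: top_sum_conjugate capped_sum_def)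
  also have "\<dots> = (\<Sum>w\<in>#W. w)"
    by (intro arg_cong[where f = sum_mset] image_mset_cong) (use assms in \<open>simp add: min_absorb1\<close>)
  finally show ?thesis by simp
qed

lemma length_filter_take_sorted:
  assumes "sorted_wrt (\<ge>) a"
  shows "length (filter (\<lambda>x. j < x) (take h a)) = min h (length (filter (\<lambda>x. j < (x::nat)) a))"
  using assms
proof (induction a arbitrary: h)
  case (Cons x a)
  show ?case
  proof (cases "j < x")
    case True
    then show ?thesis
      using Cons by (cases h) auto
  next
    case False
    then have *: "\<forall>z\<in>set (x # a). \<not> j < z"
      using Cons.prems by fastforce
    then have "filter (\<lambda>x. j < x) (x # a) = []" "filter (\<lambda>x. j < x) (take h (x # a)) = []"
      by (meson filter_False in_set_takeD)+
    then show ?thesis by simp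
  qed
qed simp

text \<open>Capping the number of entries above \<open>j\<close> at \<open>h\<close> counts just
  those among the \<open>h\<close> largest entries. Summing over \<open>j\<close> gives these
  entries back.\<close>

lemma capped_sum_conjugate:
  assumes "\<And>x. x \<in> set a \<Longrightarrow> x \<le> s"
  shows "capped_sum (mset (conjugate s (mset a))) h = top_sum a h"
proof -
  have "capped_sum (mset (conjugate s (mset a))) h
      = (\<Sum>j<s. min (size (filter_mset (\<lambda>x. j < x) (mset (desc a)))) h)"
    by (simp add: capped_sum_def conjugate_def image_mset.compositionality comp_def
        sum_unfold_sum_mset atLeast0LessThan del: mset_filter)
  also have "\<dots> = (\<Sum>j<s. size (filter_mset (\<lambda>x. j < x) (mset (take h (desc a)))))"
    by (intro sum.cong refl)
       (simp only: length_filter_take_sorted[OF sorted_desc] size_mset min.commute flip: mset_filter)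
  also have "\<dots> = capped_sum (mset (take h (desc a))) s"
    by (rule sum_size_filter)
  also have "\<dots> = top_sum a h"
    unfolding top_sum_def
  proof (rule capped_sum_eq_sum_list)
    fix x assume "x \<in> set (take h (desc a))"
    then have "x \<in> set (desc a)"
      by (rule in_set_takeD)
    then show "x \<le> s"
      using assms by (metis mset_desc set_mset_mset)
  qed
  finally show ?thesis .
qed

section \<open>Conjugation against majorization, unions and sums\<close>

abbreviation nonzeros :: "nat multiset \<Rightarrow> nat multiset" where
  "nonzeros M \<equiv> filter_mset (\<lambda>x. x \<noteq> 0) M"

lemma capped_sum_nonzeros: "capped_sum (nonzeros M) h = capped_sum M h"
  by (induction M) (auto simp: capped_sum_def)

lemma sum_mset_nonzeros: "sum_mset (nonzeros M) = sum_mset (M :: nat multiset)"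
  by (induction M) auto

text \<open>Both sides say that the totals agree and that \<open>top_sum a h\<close> is at most
  \<open>capped_sum W h\<close> for every \<open>h\<close>. The lists \<open>w\<close> are only
  known up to zeros, since \<open>part_union\<close> drops zeros that differences of profiles
  keep.\<close>

lemma majorized_conjugate_iff:
  assumes "nonzeros (mset w) = nonzeros W"
    and "\<And>u. u \<in># W \<Longrightarrow> u \<le> y" "\<And>x. x \<in> set a \<Longrightarrow> x \<le> s"
  shows "a \<prec> conjugate y W \<longleftrightarrow> w \<prec> conjugate s (mset a)"
proof -
  have "sum_list w = sum_mset W"
    by (metis assms(1) sum_mset_nonzeros sum_mset_sum_list)
  moreover have "capped_sum (mset w) h = capped_sum W h" for h
    by (metis assms(1) capped_sum_nonzeros)
  moreover have "a \<prec> conjugate y W \<longleftrightarrow>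
      sum_list a = sum_mset W \<and> (\<forall>h. top_sum a h \<le> capped_sum W h)"
    using assms(2) by (simp add: majorized_iff_top_sum top_sum_conjugate sum_list_conjugate)
  moreover have "w \<prec> conjugate s (mset a) \<longleftrightarrow>
      sum_list w = sum_list a \<and> (\<forall>h. top_sum a h \<le> capped_sum (mset w) h)"
    using assms(3) sum_list_conjugate[of "mset a" s]
    by (simp add: majorized_iff_capped_sum capped_sum_conjugate sum_mset_sum_list)
  ultimately show ?thesis by auto
qed

lemma less_length_filter_iff:
  assumes "sorted_wrt (\<ge>) a" "i < length a"
  shows "i < length (filter (\<lambda>x. j < (x::nat)) a) \<longleftrightarrow> j < a ! i"
  using assms
proof (induction a arbitrary: i)
  case (Cons x a)
  show ?case
  proof (cases "j < x")
    case True
    then show ?thesis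
      using Cons by (cases i) auto
  next
    case False
    then have *: "\<forall>z\<in>set (x # a). \<not> j < z"
      using Cons.prems by fastforce
    then have "filter (\<lambda>x. j < x) (x # a) = []"
      by (meson filter_False)
    moreover have "\<not> j < (x # a) ! i"
      using * Cons.prems(2) nth_mem by blast
    ultimately show ?thesis by (simp del: nth_Cons)
  qed
qed simp

text \<open>Since \<open>a\<close> is sorted, part \<open>i\<close> counts the \<open>j < N\<close>
  with \<open>j < a ! i\<close>, and \<open>a ! i\<close> is at most \<open>N\<close>.\<close>

lemma conjugate_conjugate:
  assumes "is_partition s a" "\<And>x. x \<in> set a \<Longrightarrow> x \<le> N"
  shows "conjugate s (mset (conjugate N (mset a))) = a"
proof (rule nth_equalityI)
  show "length (conjugate s (mset (conjugate N (mset a)))) = length a"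
    using assms(1) by (simp add: is_partition_def)
  fix i assume "i < length (conjugate s (mset (conjugate N (mset a))))"
  then have i: "i < s" "i < length a"
    using assms(1) by (simp_all add: is_partition_def)
  have "conjugate s (mset (conjugate N (mset a))) ! i
      = length (filter (\<lambda>x. i < x) (conjugate N (mset a)))"
    using i by (simp add: nth_conjugate flip: mset_filter)
  also have "\<dots> = length (filter (\<lambda>j. i < length (filter (\<lambda>x. j < x) a)) [0..<N])"
    by (simp add: conjugate_def filter_map comp_def flip: mset_filter)
  also have "\<dots> = length (filter (\<lambda>j. j < a ! i) [0..<N])"
    using less_length_filter_iff[of a i] assms(1) i by (simp add: is_partition_def)
  also have "\<dots> = card {j\<in>{..<N}. j < a ! i}"
    by (simp add: distinct_length_filter atLeast0LessThan Int_def conj_commute)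
  also have "{j\<in>{..<N}. j < a ! i} = {..<a ! i}"
    using assms(2) i by (auto intro: less_le_trans)
  finally show "conjugate s (mset (conjugate N (mset a))) ! i = a ! i"
    by simp
qed

lemma part_sum_conjugate: "part_sum (conjugate s U) (conjugate s V) = conjugate s (U + V)"
  by (rule nth_equalityI) (auto simp: part_sum_def entry_def nth_conjugate)

lemma conjugate_nonzeros: "conjugate y (nonzeros W) = conjugate y W"
  unfolding conjugate_def by (intro map_cong refl arg_cong[where f = size]) (auto simp: filter_filter_mset intro!: filter_mset_cong)

lemma mset_part_union: "mset (part_union a b) = nonzeros (mset a + mset b)"
  by (simp add: part_union_def)

lemma nonzeros_part_Union: "nonzeros (mset (part_Union as)) = nonzeros (\<Sum>a\<leftarrow>as. mset a)"
  by (induction as) (simp_all add: part_Union_def mset_part_union filter_filter_mset)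

lemma mset_part_diff:
  assumes "length a = s" "length b = s"
  shows "mset (part_diff a b) = image_mset (\<lambda>k. a ! k - b ! k) (mset_set {..<s})"
  using assms by (auto simp: part_diff_def entry_def atLeast0LessThan[symmetric] intro!: image_mset_cong)

section \<open>Equivalence of the two statements\<close>

text \<open>Otherwise one plus the product of all monic linear polynomials has positive degree but
  no root. The lemma supplies as many distinct points as there are pairs of partitions.\<close>

lemma infinite_UNIV_alg_closed: "infinite (UNIV :: 'a::alg_closed_field set)"
proof
  assume fin: "finite (UNIV :: 'a set)"
  define q where "q = (\<Prod>a\<in>UNIV. [:- a, 1 :: 'a:])"
  have "degree q = (\<Sum>a\<in>(UNIV :: 'a set). 1)"
    unfolding q_def by (subst degree_prod_sum_eq) auto
  then have "degree q > 0"
    using fin by (simp add: card_gt_0_iff)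
  then have "degree (q + 1) > 0"
    by (simp add: degree_add_eq_left)
  then obtain x where "poly (q + 1) x = 0"
    using alg_closed_imp_poly_has_root by blast
  moreover have "poly q x = 0"
    unfolding q_def using fin by (simp add: poly_prod)
  ultimately show False by simp
qed

lemma bounded_realize:
  assumes "finite S"
  shows "bounded_chain S s x (realize S s x F)"
proof -
  have "card {k. k < s \<and> int x - i < int (F P k)} \<le> card {..<s}" for i P
    by (intro card_mono) auto
  then have "count (realize S s x F i) P \<le> s" for i P
    using assms by (simp add: count_realize)
  moreover have "set_mset (realize S s x F i) \<subseteq> S" for i
    using assms by (auto simp: count_realize simp flip: count_greater_zero_iff split: if_splits)
  ultimately show ?thesis
    by (simp add: bounded_chain_def)
qed

lemma profile_outside:
  assumes "bounded_chain S s x a" "P \<notin> S \<or> s \<le> k"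
  shows "profile x a P k = 0"
proof -
  have "\<not> k < count (a i) P" if "i \<le> int x" for i
  proof -
    have "count (a i) P \<le> s" "P \<in># a i \<Longrightarrow> P \<in> S"
      using assms(1) that by (auto simp: bounded_chain_def)
    then show ?thesis
      using assms(2) by (auto simp flip: count_greater_zero_iff)
  qed
  then have "{i\<in>{1..int x}. k < count (a i) P} = {}"
    by auto
  then show ?thesis
    by (simp only: profile_def card.empty)
qed

lemma is_partition_nth_le: "is_partition s t \<Longrightarrow> i \<le> j \<Longrightarrow> j < s \<Longrightarrow> t ! j \<le> t ! i"
  by (cases "i = j") (auto simp: is_partition_def sorted_wrt_iff_nth_less)

lemma profile_partition: "is_partition s (map (profile x a P) [0..<s])"
  by (auto simp: is_partition_def sorted_wrt_iff_nth_less intro: profile_antimono)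

lemma sum_list_map_upt_1: "(\<Sum>i\<leftarrow>[1..<k + 1]. g i) = (\<Sum>i\<in>{1..k}. g i :: 'b::comm_monoid_add)"
  by (simp add: interv_sum_list_conv_sum_set_nat atLeastLessThanSuc_atLeastAtMost del: upt_Suc)

lemma image_mset_set_Times:
  assumes "finite S" "finite T"
  shows "image_mset f (mset_set (S \<times> T)) = (\<Sum>P\<in>S. image_mset (\<lambda>k. f (P, k)) (mset_set T))"
  using assms(1)
proof (induction S rule: finite_induct)
  case (insert P S)
  have "mset_set (insert P S \<times> T) = mset_set (Pair P ` T) + mset_set (S \<times> T)"
    using insert assms(2) by (subst mset_set_Union[symmetric]) (auto simp: insert_Times_insert intro!: arg_cong[where f = mset_set])
  also have "mset_set (Pair P ` T) = image_mset (Pair P) (mset_set T)"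
    by (simp add: image_mset_mset_set inj_on_def)
  finally show ?case
    using insert by (simp add: multiset.map_comp comp_def)
qed simp

definition diff_union :: "nat \<Rightarrow> (nat \<Rightarrow> nat list) \<Rightarrow> (nat \<Rightarrow> nat list) \<Rightarrow> nat list" where
  "diff_union k d t = part_Union (map (\<lambda>i. part_diff (d i) (t i)) [1..<k + 1])"

lemma nonzeros_diff_union:
  assumes "\<And>i. i \<in> {1..k} \<Longrightarrow> length (d i) = s \<and> length (t i) = s"
  shows "nonzeros (mset (diff_union k d t))
    = nonzeros (\<Sum>i\<in>{1..k}. image_mset (\<lambda>j. d i ! j - t i ! j) (mset_set {..<s}))"
proof -
  have "(\<Sum>a\<leftarrow>map (\<lambda>i. part_diff (d i) (t i)) [1..<k + 1]. mset a)
      = (\<Sum>i\<in>{1..k}. mset (part_diff (d i) (t i)))"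
    by (simp only: map_map comp_def sum_list_map_upt_1)
  also have "\<dots> = (\<Sum>i\<in>{1..k}. image_mset (\<lambda>j. d i ! j - t i ! j) (mset_set {..<s}))"
    by (intro sum.cong refl mset_part_diff) (use assms in auto)
  finally show ?thesis
    by (simp only: diff_union_def nonzeros_part_Union)
qed

lemma set_conjugate_le: "x \<in> set (conjugate s W) \<Longrightarrow> x \<le> size W"
  by (auto simp: conjugate_def intro: size_mset_mono)

text \<open>A part of a conjugate is at most the number of members of \<open>W\<close>. This turns
  majorization into the upper bounds that interlacing demands.\<close>

lemma diff_union_bound:
  assumes "\<And>i. i \<in> {1..k} \<Longrightarrow> length (d i) = s \<and> length (t i) = s"
    and "diff_union k d t \<prec> conjugate y W" "i \<in> {1..k}" "j < s"
  shows "d i ! j - t i ! j \<le> size W"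
proof (cases "d i ! j - t i ! j = 0")
  case False
  have "d i ! j - t i ! j \<in># (\<Sum>i\<in>{1..k}. image_mset (\<lambda>j. d i ! j - t i ! j) (mset_set {..<s}))"
    using assms(3,4) by (auto simp: set_mset_sum)
  with False have "d i ! j - t i ! j \<in># nonzeros (mset (diff_union k d t))"
    by (subst nonzeros_diff_union[where s = s]) (use assms(1) in auto)
  then have "d i ! j - t i ! j \<in> set (diff_union k d t)"
    by simp
  then show ?thesis
    using majorized_bound[OF assms(2), of "size W"] set_conjugate_le by blast
qed simp

section \<open>Dictionary between families of partitions and chains: the \<open>i\<close>-th
  partition is the profile at the point \<open>h i\<close>\<close>

locale profile_lists =
  fixes S :: "'p set" and h :: "nat \<Rightarrow> 'p" and k s :: nat
  assumes bij: "bij_betw h {1..k} S"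
begin

lemma finite_S: "finite S"
  using bij bij_betw_finite by blast

definition lists_of :: "nat \<Rightarrow> (int \<Rightarrow> 'p multiset) \<Rightarrow> (nat \<Rightarrow> nat list) \<Rightarrow> bool" where
  "lists_of x a t \<longleftrightarrow> (\<forall>i\<in>{1..k}. length (t i) = s \<and> (\<forall>j<s. t i ! j = profile x a (h i) j))"

definition chain_of :: "nat \<Rightarrow> (nat \<Rightarrow> nat list) \<Rightarrow> int \<Rightarrow> 'p multiset" where
  "chain_of x t = realize S s x (\<lambda>P j. t (inv_into {1..k} h P) ! j)"

lemma lists_of_profile: "lists_of x a (\<lambda>i. map (profile x a (h i)) [0..<s])"
  by (simp add: lists_of_def)

lemma lists_of_chain_of:
  assumes "\<And>i. i \<in> {1..k} \<Longrightarrow> is_partition s (t i)"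
    and "\<And>i j. i \<in> {1..k} \<Longrightarrow> j < s \<Longrightarrow> t i ! j \<le> x"
  shows "lists_of x (chain_of x t) t"
  unfolding lists_of_def
proof (intro ballI conjI allI impI)
  fix i assume i: "i \<in> {1..k}"
  then have inv: "inv_into {1..k} h (h i) = i" "h i \<in> S"
    using bij by (auto simp: bij_betw_def)
  show "length (t i) = s"
    using assms(1)[OF i] by (simp add: is_partition_def)
  fix j assume "j < s"
  then have "profile x (chain_of x t) (h i) j = t (inv_into {1..k} h (h i)) ! j"
    unfolding chain_of_def using inv
    by (intro profile_realize finite_S)
       (simp_all add: is_partition_nth_le[OF assms(1)[OF i]] assms(2)[OF i])
  then show "t i ! j = profile x (chain_of x t) (h i) j"
    by (simp only: inv)
qed

lemma point_chain_chain_of: "point_chain x (chain_of x t)"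
  and bounded_chain_of: "bounded_chain S s x (chain_of x t)"
  unfolding chain_of_def using finite_S by (rule point_chain_realize bounded_realize)+

text \<open>Outside the window both profiles are 0 and the inequalities hold trivially, so the
  entries of the lists decide.\<close>

lemma points_interlaced_lists:
  assumes a: "point_chain x a" "bounded_chain S s x a" "lists_of x a t"
    and e: "point_chain (x + y) e" "bounded_chain S s (x + y) e" "lists_of (x + y) e d"
  shows "points_interlaced x y a e \<longleftrightarrow>
    (\<forall>i\<in>{1..k}. \<forall>j<s. t i ! j \<le> d i ! j \<and> d i ! j \<le> t i ! j + y)"
proof -
  have zero: "profile x a P j = 0 \<and> profile (x + y) e P j = 0" if "P \<notin> S \<or> \<not> j < s" for P j
    using that profile_outside[OF a(2)] profile_outside[OF e(2)] by (simp add: not_less)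
  have "(\<forall>i\<in>{1..k}. \<forall>j<s. t i ! j \<le> d i ! j \<and> d i ! j \<le> t i ! j + y) \<longleftrightarrow>
      (\<forall>i\<in>{1..k}. \<forall>j<s. profile x a (h i) j \<le> profile (x + y) e (h i) j \<and>
        profile (x + y) e (h i) j \<le> profile x a (h i) j + y)"
    using a(3) e(3) by (simp add: lists_of_def)
  also have "\<dots> \<longleftrightarrow> (\<forall>P\<in>S. \<forall>j<s. profile x a P j \<le> profile (x + y) e P j \<and>
        profile (x + y) e P j \<le> profile x a P j + y)"
    using bij unfolding bij_betw_def by blast
  also have "\<dots> \<longleftrightarrow> (\<forall>P j. profile x a P j \<le> profile (x + y) e P j \<and>
        profile (x + y) e P j \<le> profile x a P j + y)"
    using zero by (metis le0 not_le)
  finally show ?thesis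
    using points_interlaced_iff_profile[OF a(1) e(1)] by simp
qed

end

locale profile_lists_forms = profile_lists S h k s
  for S :: "'a::{alg_closed_field, field_gcd} option set" and h k s
begin

text \<open>The translation between the two statements: the degrees are the conjugate of the profile
  differences, which are the parts of \<open>diff_union\<close> up to zeros, and moving the
  conjugation to the other side reverses the relation. Interlacing bounds the differences by
  \<open>y\<close>.\<close>

lemma majorized_sigma_degrees_iff:
  assumes a: "point_chain x a" "lists_of x a t"
    and e: "point_chain (x + y) e" "bounded_chain S s (x + y) e" "lists_of (x + y) e d"
    and ae: "points_interlaced x y a e"
    and c: "\<And>z. z \<in> set c \<Longrightarrow> z \<le> s"
  shows "c \<prec> sigma_degrees x y (form_chain x a) (form_chain (x + y) e) \<longleftrightarrow>
    diff_union k d t \<prec> conjugate s (mset c)"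
proof -
  define D where "D P j = profile (x + y) e P j - profile x a P j" for P j
  have "(\<Sum>i\<in>{1..k}. image_mset (\<lambda>j. d i ! j - t i ! j) (mset_set {..<s}))
      = (\<Sum>i\<in>{1..k}. image_mset (D (h i)) (mset_set {..<s}))"
    using a(2) e(3) by (intro sum.cong refl image_mset_cong) (simp add: lists_of_def D_def)
  also have "\<dots> = (\<Sum>P\<in>S. image_mset (D P) (mset_set {..<s}))"
    by (rule sum.reindex_bij_betw[OF bij])
  also have "\<dots> = profile_diffs S s x y a e"
    using finite_S by (simp add: profile_diffs_def image_mset_set_Times D_def[abs_def])
  finally have "nonzeros (mset (diff_union k d t)) = nonzeros (profile_diffs S s x y a e)"
    using a(2) e(3) by (subst nonzeros_diff_union[of k d s t]) (auto simp: lists_of_def)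
  moreover have "u \<le> y" if u: "u \<in># profile_diffs S s x y a e" for u
  proof -
    obtain P j where "u = profile (x + y) e P j - profile x a P j"
      using u finite_S by (auto simp: profile_diffs_def)
    moreover have "profile (x + y) e P j \<le> profile x a P j + y"
      using ae points_interlaced_iff_profile[OF a(1) e(1)] by blast
    ultimately show ?thesis by simp
  qed
  ultimately have "c \<prec> conjugate y (profile_diffs S s x y a e) \<longleftrightarrow>
      diff_union k d t \<prec> conjugate s (mset c)"
    using c by (rule majorized_conjugate_iff)
  then show ?thesis
    using sigma_degrees_form_chain[OF finite_S a(1) e(1,2) ae] by simp
qed

end

section \<open>The two statements and the two implications\<close>

definition chain_statement :: "'a::{alg_closed_field, field_gcd} itself \<Rightarrow> bool" where
  "chain_statement _ \<longleftrightarrow>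
    (\<forall>(n::nat) (m::nat) (p::nat)
      (\<alpha> :: int \<Rightarrow> 'a poly poly)
      (\<gamma> :: int \<Rightarrow> 'a poly poly) (c :: nat list) (r :: nat list).
      hom_chain n \<alpha> \<and> hom_chain (n + m + p) \<gamma> \<and>
      is_partition m c \<and> is_partition p r \<and>
      interlaced n (m + p) \<alpha> \<gamma> \<and>
      part_union (map (\<lambda>x. x + 1) c) (map (\<lambda>x. x + 1) r) \<prec> sigma_degrees n (m + p) \<alpha> \<gamma>
      \<longrightarrow>
      (\<exists>\<beta> :: int \<Rightarrow> 'a poly poly.
         hom_chain (n + m) \<beta> \<and>
         interlaced n m \<alpha> \<beta> \<and>
         interlaced (n + m) p \<beta> \<gamma> \<and>
         map (\<lambda>x. x + 1) c \<prec> sigma_degrees n m \<alpha> \<beta> \<and>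
         map (\<lambda>x. x + 1) r \<prec> sigma_degrees (n + m) p \<beta> \<gamma>))"

definition partition_statement :: bool where
  "partition_statement \<longleftrightarrow>
    (\<forall>(s::nat) (k::nat) (d :: nat \<Rightarrow> nat list) (t :: nat \<Rightarrow> nat list)
      (A :: nat list) (B :: nat list).
      s \<ge> 1 \<and> k \<ge> 1 \<and>
      (\<forall>i\<in>{1..k}. is_partition s (d i) \<and> is_partition s (t i) \<and> (\<forall>j<s. d i ! j \<ge> t i ! j)) \<and>
      is_partition s A \<and> is_partition s B \<and>
      diff_union k d t \<prec> part_sum A B
      \<longrightarrow>
      (\<exists>f :: nat \<Rightarrow> nat list.
         (\<forall>i\<in>{1..k}. is_partition s (f i) \<and> (\<forall>j<s. d i ! j \<ge> f i ! j \<and> f i ! j \<ge> t i ! j)) \<and>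
         diff_union k f t \<prec> A \<and>
         diff_union k d f \<prec> B))"

lemma conjugate_part_union:
  "conjugate s (mset (part_union a b)) = part_sum (conjugate s (mset a)) (conjugate s (mset b))"
  by (simp only: mset_part_union conjugate_nonzeros part_sum_conjugate)

lemma set_part_union: "set (part_union a b) \<subseteq> set a \<union> set b"
  by (simp add: mset_part_union subset_iff flip: set_mset_mset)

text \<open>The profiles of the given chains are fed into the partition statement with the
  conjugates of \<open>c'\<close> and \<open>r'\<close>; the chain realizing the resulting
  \<open>f\<close> is the required one.\<close>

lemma partition_imp_chain:
  assumes partition_statement
  shows "chain_statement TYPE('a::{alg_closed_field, field_gcd})"
  unfolding chain_statement_def
proof (intro allI impI)
  fix n m p :: nat and \<alpha> \<gamma> :: "int \<Rightarrow> 'a poly poly" and c r :: "nat list"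
  define c' r' where "c' = map (\<lambda>x. x + 1) c" and "r' = map (\<lambda>x. x + 1) r"
  assume *: "hom_chain n \<alpha> \<and> hom_chain (n + m + p) \<gamma> \<and>
      is_partition m c \<and> is_partition p r \<and>
      interlaced n (m + p) \<alpha> \<gamma> \<and>
      part_union (map (\<lambda>x. x + 1) c) (map (\<lambda>x. x + 1) r) \<prec> sigma_degrees n (m + p) \<alpha> \<gamma>"
  obtain a where a: "point_chain n a" "\<alpha> = form_chain n a"
    using * hom_chain_imp_form_chain by metis
  obtain g where g: "point_chain (n + m + p) g" "\<gamma> = form_chain (n + m + p) g"
    using * hom_chain_imp_form_chain by metis
  let ?G = "g (int (n + m + p))"
  \<comment> \<open>The largest multiset of the chain contains all its points; the extra point makes
    \<open>k\<close> positive even if there are none.\<close>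
  define S where "S = insert None (set_mset ?G)"
  \<comment> \<open>Positive, and large enough to bound all multiplicities and all entries of
    \<open>c'\<close> and \<open>r'\<close>.\<close>
  define s where "s = Suc (size ?G + sum_list c' + sum_list r')"
  define k where "k = card S"
  have "finite S"
    by (simp add: S_def)
  then have "k \<ge> 1" "s \<ge> 1"
    by (auto simp: k_def s_def S_def card_gt_0_iff Suc_le_eq)
  obtain h where "bij_betw h {1..k} S"
    using ex_bij_betw_nat_finite_1[OF \<open>finite S\<close>] by (auto simp: k_def)
  then interpret profile_lists_forms S h k s
    by unfold_locales
  have g_bounded: "bounded_chain S s (n + m + p) g"
    unfolding bounded_chain_def
  proof (intro allI impI conjI)
    fix i assume "i \<le> int (n + m + p)"
    then have "g i \<subseteq># ?G"
      using g(1) unfolding point_chain_def by blast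
    then show "set_mset (g i) \<subseteq> S"
      by (auto simp: S_def dest: mset_subset_eqD)
    fix P
    have "count (g i) P \<le> count ?G P"
      using \<open>g i \<subseteq># ?G\<close> by (rule mset_subset_eq_count)
    also have "\<dots> \<le> size ?G"
      by (rule count_le_size)
    finally show "count (g i) P \<le> s"
      by (simp add: s_def)
  qed
  have ag: "points_interlaced n (m + p) a g"
    using * interlaced_form_chain[of n "m + p" a g] a g by (simp add: add.assoc)
  have a_bounded: "bounded_chain S s n a"
    using bounded_chain_lower[OF ag a(1)] g_bounded by (simp add: add.assoc)
  have c'_le: "z \<le> s" if "z \<in> set c'" for z
    using member_le_sum_list[OF that] by (simp add: s_def)
  have r'_le: "z \<le> s" if "z \<in> set r'" for z
    using member_le_sum_list[OF that] by (simp add: s_def)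
  define d t where "d = (\<lambda>i. map (profile (n + m + p) g (h i)) [0..<s])"
    and "t = (\<lambda>i. map (profile n a (h i)) [0..<s])"
  have d: "lists_of (n + m + p) g d" and t: "lists_of n a t"
    unfolding d_def t_def by (rule lists_of_profile)+
  have dt: "t i ! j \<le> d i ! j" if "i \<in> {1..k}" "j < s" for i j
    using points_interlaced_lists[of n a t "m + p" g d] ag a(1) a_bounded t g(1) g_bounded d that
    by (auto simp: add.assoc)
  have "part_union c' r' \<prec> sigma_degrees n (m + p) (form_chain n a) (form_chain (n + (m + p)) g)"
    using * by (simp only: a(2) g(2) c'_def r'_def add.assoc)
  moreover have "z \<le> s" if "z \<in> set (part_union c' r')" for z
    using that set_part_union c'_le r'_le by blast
  ultimately have "diff_union k d t \<prec> conjugate s (mset (part_union c' r'))"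
    using majorized_sigma_degrees_iff[OF a(1) t g(1)[unfolded add.assoc] g_bounded[unfolded add.assoc]
        d[unfolded add.assoc] ag] by blast
  then have "diff_union k d t \<prec> part_sum (conjugate s (mset c')) (conjugate s (mset r'))"
    by (simp add: conjugate_part_union)
  moreover have "\<forall>i\<in>{1..k}. is_partition s (d i) \<and> is_partition s (t i) \<and> (\<forall>j<s. t i ! j \<le> d i ! j)"
    by (intro ballI conjI allI impI dt) (simp_all add: d_def t_def profile_partition)
  ultimately have "\<exists>f. (\<forall>i\<in>{1..k}. is_partition s (f i) \<and> (\<forall>j<s. d i ! j \<ge> f i ! j \<and> f i ! j \<ge> t i ! j)) \<and>
      diff_union k f t \<prec> conjugate s (mset c') \<and> diff_union k d f \<prec> conjugate s (mset r')"
    using assms[unfolded partition_statement_def, rule_format,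
        of s k d t "conjugate s (mset c')" "conjugate s (mset r')"]
      \<open>s \<ge> 1\<close> \<open>k \<ge> 1\<close> is_partition_conjugate by simp
  then obtain f where f0: "\<forall>i\<in>{1..k}. is_partition s (f i) \<and> (\<forall>j<s. f i ! j \<le> d i ! j \<and> t i ! j \<le> f i ! j)"
    and f12: "diff_union k f t \<prec> conjugate s (mset c')" "diff_union k d f \<prec> conjugate s (mset r')"
    by (elim exE conjE)
  then have f: "is_partition s (f i)" "j < s \<Longrightarrow> f i ! j \<le> d i ! j \<and> t i ! j \<le> f i ! j"
    if "i \<in> {1..k}" for i j
    using that by blast+
  have len: "length (f i) = s \<and> length (t i) = s" "length (d i) = s \<and> length (f i) = s"
    if "i \<in> {1..k}" for i
    using f(1)[OF that] by (simp_all add: is_partition_def d_def t_def)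
  have "length c' = m" "length r' = p"
    using * by (simp_all add: c'_def r'_def is_partition_def)
  \<comment> \<open>The upper bounds of interlacing are no part of the partition statement; they
    come from majorization, as \<open>c'\<close> and \<open>r'\<close> have \<open>m\<close> and
    \<open>p\<close> entries. The first also makes \<open>f\<close> fit into a chain of length
    \<open>n + m\<close>.\<close>
  then have ft: "f i ! j - t i ! j \<le> m" and df: "d i ! j - f i ! j \<le> p"
    if "i \<in> {1..k}" "j < s" for i j
    using diff_union_bound[OF len(1) f12(1) that] diff_union_bound[OF len(2) f12(2) that] by simp_all
  define b where "b = chain_of (n + m) f"
  have b: "point_chain (n + m) b" "bounded_chain S s (n + m) b"
    unfolding b_def by (rule point_chain_chain_of bounded_chain_of)+
  have fb: "lists_of (n + m) b f"
    unfolding b_def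
  proof (rule lists_of_chain_of)
    fix i j assume ij: "i \<in> {1..k}" "j < s"
    have "t i ! j \<le> n"
      using ij by (simp add: t_def profile_le)
    then show "f i ! j \<le> n + m"
      using ft[OF ij] by simp
  qed (rule f(1))
  have ab: "points_interlaced n m a b"
    using points_interlaced_lists[OF a(1) a_bounded t b fb] f(2) ft by (force simp: le_diff_conv)
  have bg: "points_interlaced (n + m) p b g"
    using points_interlaced_lists[OF b fb g(1) g_bounded d] f(2) df by (force simp: le_diff_conv)
  have "c' \<prec> sigma_degrees n m \<alpha> (form_chain (n + m) b)"
    using majorized_sigma_degrees_iff[OF a(1) t b fb ab c'_le] f12(1) a(2) by simp
  moreover have "r' \<prec> sigma_degrees (n + m) p (form_chain (n + m) b) \<gamma>"
    using majorized_sigma_degrees_iff[OF b(1) fb g(1) g_bounded d bg r'_le] f12(2) g(2) by simp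
  moreover have "interlaced n m \<alpha> (form_chain (n + m) b)"
    "interlaced (n + m) p (form_chain (n + m) b) \<gamma>"
    using ab bg a(2) g(2) interlaced_form_chain by auto
  ultimately show "\<exists>\<beta> :: int \<Rightarrow> 'a poly poly.
         hom_chain (n + m) \<beta> \<and>
         interlaced n m \<alpha> \<beta> \<and>
         interlaced (n + m) p \<beta> \<gamma> \<and>
         map (\<lambda>x. x + 1) c \<prec> sigma_degrees n m \<alpha> \<beta> \<and>
         map (\<lambda>x. x + 1) r \<prec> sigma_degrees (n + m) p \<beta> \<gamma>"
    using hom_chain_form_chain[OF b(1)] by (auto simp: c'_def r'_def)
qed

text \<open>Cut to exactly \<open>A ! 0\<close> parts, the conjugate of \<open>A\<close> has only
  positive parts, because \<open>A ! 0\<close> itself exceeds every \<open>j\<close> in range. So 1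
  can be subtracted throughout.\<close>

lemma partition_conjugate_Suc:
  assumes "is_partition s A" "s \<ge> 1"
  obtains c where "is_partition (A ! 0) c" "conjugate s (mset (map (\<lambda>x. x + 1) c)) = A"
    "\<And>z. z \<in> set (map (\<lambda>x. x + 1) c) \<Longrightarrow> z \<le> s"
proof -
  define c' where "c' = conjugate (A ! 0) (mset A)"
  have le: "x \<le> A ! 0" if "x \<in> set A" for x
    using that assms is_partition_nth_le[OF assms(1), of 0]
    by (auto simp: in_set_conv_nth is_partition_def)
  have "z \<ge> 1" if "z \<in> set c'" for z
  proof -
    obtain j where "j < A ! 0" "z = length (filter (\<lambda>x. j < x) A)"
      using \<open>z \<in> set c'\<close> by (auto simp: c'_def conjugate_def simp flip: mset_filter)
    moreover have "A ! 0 \<in> set A"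
      using assms by (simp add: is_partition_def)
    ultimately show "z \<ge> 1"
      by (auto simp: Suc_le_eq filter_empty_conv)
  qed
  then have c': "map (\<lambda>x. x + 1) (map (\<lambda>x. x - 1) c') = c'"
    unfolding map_map by (intro map_idI) fastforce
  have "is_partition (A ! 0) c'"
    unfolding c'_def by (rule is_partition_conjugate)
  then have "is_partition (A ! 0) (map (\<lambda>x. x - 1) c')"
    by (auto simp: is_partition_def sorted_wrt_iff_nth_less diff_le_mono)
  moreover have "conjugate s (mset c') = A"
    unfolding c'_def using assms(1) le by (rule conjugate_conjugate)
  moreover have "z \<le> s" if "z \<in> set c'" for z
    using set_conjugate_le[of z "A ! 0" "mset A"] that assms(1) by (simp add: c'_def is_partition_def)
  ultimately show thesis
    using that[of "map (\<lambda>x. x - 1) c'"] unfolding c' by blast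
qed

text \<open>The reverse passage: \<open>t\<close> and \<open>d\<close> are realized as chains at
  \<open>k\<close> distinct points, and the profiles of the chain between them are the required
  partitions.\<close>

lemma chain_imp_partition:
  assumes "chain_statement TYPE('a::{alg_closed_field, field_gcd})"
  shows partition_statement
  unfolding partition_statement_def
proof (intro allI impI)
  fix s k :: nat and d t :: "nat \<Rightarrow> nat list" and A B :: "nat list"
  assume *: "s \<ge> 1 \<and> k \<ge> 1 \<and>
      (\<forall>i\<in>{1..k}. is_partition s (d i) \<and> is_partition s (t i) \<and> (\<forall>j<s. d i ! j \<ge> t i ! j)) \<and>
      is_partition s A \<and> is_partition s B \<and>
      diff_union k d t \<prec> part_sum A B"
  define m p where "m = A ! 0" and "p = B ! 0"
  obtain c where c: "is_partition m c" "conjugate s (mset (map (\<lambda>x. x + 1) c)) = A"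
      "\<And>z. z \<in> set (map (\<lambda>x. x + 1) c) \<Longrightarrow> z \<le> s"
    using partition_conjugate_Suc[of s A] * by (metis m_def)
  obtain r where r: "is_partition p r" "conjugate s (mset (map (\<lambda>x. x + 1) r)) = B"
      "\<And>z. z \<in> set (map (\<lambda>x. x + 1) r) \<Longrightarrow> z \<le> s"
    using partition_conjugate_Suc[of s B] * by (metis p_def)
  define c' r' where "c' = map (\<lambda>x. x + 1) c" and "r' = map (\<lambda>x. x + 1) r"
  note c = c[folded c'_def] and r = r[folded r'_def]
  obtain q :: "nat \<Rightarrow> 'a" where "inj q"
    using infinite_countable_subset[OF infinite_UNIV_alg_closed] by auto
  \<comment> \<open>Distinct points of the affine line, one for each pair of partitions.\<close>
  define h where "h = Some \<circ> q"
  define S where "S = h ` {1..k}"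
  have "inj h"
    using \<open>inj q\<close> by (simp add: h_def inj_on_def)
  then have "bij_betw h {1..k} S"
    unfolding S_def by (intro inj_on_imp_bij_betw) (rule inj_on_subset, auto)
  then interpret profile_lists_forms S h k s
    by unfold_locales
  have du: "diff_union k d t \<prec> part_sum A B"
    using * by blast
  have len: "length (d i) = s \<and> length (t i) = s" if "i \<in> {1..k}" for i
    using * that by (auto simp: is_partition_def)
  have "size (mset c' + mset r') = m + p"
    using c(1) r(1) by (simp add: is_partition_def c'_def r'_def)
  moreover have du': "diff_union k d t \<prec> conjugate s (mset c' + mset r')"
    using du part_sum_conjugate[of s "mset c'" "mset r'"] c(2) r(2) by simp
  ultimately have dt: "d i ! j \<le> t i ! j + (m + p)" if "i \<in> {1..k}" "j < s" for i j
    using diff_union_bound[OF len du' that] by (simp add: le_diff_conv add.commute)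
  \<comment> \<open>Any common bound of the entries of all \<open>t i\<close> serves as the length
    of the first chain; the sum of the first entries is one.\<close>
  define n where "n = (\<Sum>i\<in>{1..k}. t i ! 0)"
  have t_le: "t i ! j \<le> n" if "i \<in> {1..k}" "j < s" for i j
  proof -
    have "t i ! j \<le> t i ! 0"
      using * that by (auto intro: is_partition_nth_le)
    also have "\<dots> \<le> n"
      unfolding n_def using that by (intro member_le_sum) auto
    finally show ?thesis .
  qed
  define a g where "a = chain_of n t" and "g = chain_of (n + m + p) d"
  have a: "point_chain n a" "bounded_chain S s n a"
    unfolding a_def by (rule point_chain_chain_of bounded_chain_of)+
  have g: "point_chain (n + m + p) g" "bounded_chain S s (n + m + p) g"
    unfolding g_def by (rule point_chain_chain_of bounded_chain_of)+
  have t: "lists_of n a t"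
    unfolding a_def using * t_le by (intro lists_of_chain_of) auto
  have "d i ! j \<le> n + m + p" if "i \<in> {1..k}" "j < s" for i j
    using dt[OF that] t_le[OF that] by simp
  then have d: "lists_of (n + m + p) g d"
    unfolding g_def using * by (intro lists_of_chain_of) auto
  have ag: "points_interlaced n (m + p) a g"
    using points_interlaced_lists[of n a t "m + p" g d] a t g d dt * by (simp add: add.assoc)
  have "z \<le> s" if "z \<in> set (part_union c' r')" for z
    using that set_part_union c(3) r(3) by blast
  then have "part_union c' r' \<prec> sigma_degrees n (m + p) (form_chain n a) (form_chain (n + m + p) g)"
    using majorized_sigma_degrees_iff[OF a(1) t g[unfolded add.assoc] d[unfolded add.assoc] ag,
        of "part_union c' r'"] du c(2) r(2)
    by (simp add: add.assoc conjugate_part_union)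
  then obtain \<beta> :: "int \<Rightarrow> 'a poly poly" where \<beta>:
      "hom_chain (n + m) \<beta>" "interlaced n m (form_chain n a) \<beta>"
      "interlaced (n + m) p \<beta> (form_chain (n + m + p) g)"
      "c' \<prec> sigma_degrees n m (form_chain n a) \<beta>"
      "r' \<prec> sigma_degrees (n + m) p \<beta> (form_chain (n + m + p) g)"
    using assms[unfolded chain_statement_def, rule_format,
        of n "form_chain n a" m p "form_chain (n + m + p) g" c r]
      hom_chain_form_chain[OF a(1)] hom_chain_form_chain[OF g(1)] c(1) r(1) ag
      interlaced_form_chain[of n "m + p" a g]
    by (auto simp: c'_def r'_def add.assoc)
  obtain b where b: "point_chain (n + m) b" "\<beta> = form_chain (n + m) b"
    using \<beta>(1) hom_chain_imp_form_chain by metis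
  have ab: "points_interlaced n m a b" and bg: "points_interlaced (n + m) p b g"
    using \<beta>(2,3) interlaced_form_chain by (auto simp: b(2))
  \<comment> \<open>The chain obtained lies below \<open>g\<close>, so it brings in no new points
    and no higher multiplicities: its profiles in the window tell everything.\<close>
  have b_bounded: "bounded_chain S s (n + m) b"
    using bounded_chain_lower[OF bg b(1) g(2)] .
  define f where "f = (\<lambda>i. map (profile (n + m) b (h i)) [0..<s])"
  have f: "lists_of (n + m) b f"
    unfolding f_def by (rule lists_of_profile)
  have "diff_union k f t \<prec> A"
    using majorized_sigma_degrees_iff[OF a(1) t b(1) b_bounded f ab c(3)] \<beta>(4) b(2) c(2) by simp
  moreover have "diff_union k d f \<prec> B"
    using majorized_sigma_degrees_iff[OF b(1) f g d bg r(3)] \<beta>(5) b(2) r(2) by simp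
  moreover have "is_partition s (f i)" for i
    unfolding f_def by (rule profile_partition)
  moreover have "t i ! j \<le> f i ! j" "f i ! j \<le> d i ! j" if "i \<in> {1..k}" "j < s" for i j
    using points_interlaced_lists[OF a t b(1) b_bounded f] ab
      points_interlaced_lists[OF b(1) b_bounded f g d] bg that by blast+
  ultimately show "\<exists>f. (\<forall>i\<in>{1..k}. is_partition s (f i) \<and> (\<forall>j<s. d i ! j \<ge> f i ! j \<and> f i ! j \<ge> t i ! j)) \<and>
         diff_union k f t \<prec> A \<and>
         diff_union k d f \<prec> B"
    by blast
qed

theorem theorem2:
  shows
  "(\<forall>(n::nat) (m::nat) (p::nat)
      (\<alpha> :: int \<Rightarrow> 'a::{alg_closed_field, field_gcd} poly poly)
      (\<gamma> :: int \<Rightarrow> 'a poly poly) (c :: nat list) (r :: nat list).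
      hom_chain n \<alpha> \<and> hom_chain (n + m + p) \<gamma> \<and>
      is_partition m c \<and> is_partition p r \<and>
      interlaced n (m + p) \<alpha> \<gamma> \<and>
      part_union (map (\<lambda>x. x + 1) c) (map (\<lambda>x. x + 1) r) \<prec> sigma_degrees n (m + p) \<alpha> \<gamma>
      \<longrightarrow>
      (\<exists>\<beta> :: int \<Rightarrow> 'a poly poly.
         hom_chain (n + m) \<beta> \<and>
         interlaced n m \<alpha> \<beta> \<and>
         interlaced (n + m) p \<beta> \<gamma> \<and>
         map (\<lambda>x. x + 1) c \<prec> sigma_degrees n m \<alpha> \<beta> \<and>
         map (\<lambda>x. x + 1) r \<prec> sigma_degrees (n + m) p \<beta> \<gamma>))
   \<longleftrightarrow>
   (\<forall>(s::nat) (k::nat) (d :: nat \<Rightarrow> nat list) (t :: nat \<Rightarrow> nat list)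
      (A :: nat list) (B :: nat list).
      s \<ge> 1 \<and> k \<ge> 1 \<and>
      (\<forall>i\<in>{1..k}. is_partition s (d i) \<and> is_partition s (t i) \<and> (\<forall>j<s. d i ! j \<ge> t i ! j)) \<and>
      is_partition s A \<and> is_partition s B \<and>
      part_Union (map (\<lambda>i. part_diff (d i) (t i)) [1..<k + 1]) \<prec> part_sum A B
      \<longrightarrow>
      (\<exists>f :: nat \<Rightarrow> nat list.
         (\<forall>i\<in>{1..k}. is_partition s (f i) \<and> (\<forall>j<s. d i ! j \<ge> f i ! j \<and> f i ! j \<ge> t i ! j)) \<and>
         part_Union (map (\<lambda>i. part_diff (f i) (t i)) [1..<k + 1]) \<prec> A \<and>
         part_Union (map (\<lambda>i. part_diff (d i) (f i)) [1..<k + 1]) \<prec> B))"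
proof -
  have "chain_statement TYPE('a) \<longleftrightarrow> partition_statement"
    using chain_imp_partition partition_imp_chain by blast
  then show ?thesis
    unfolding chain_statement_def partition_statement_def diff_union_def .
qed

end
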